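(* Let $n\ge1$ and let $\mathcal{L}$ be the vertex labeling of the linear representation of some linked cycle on $[n]$, and let $LC_n(\mathcal{L})$ be the set of linked cycles on $[n]$ whose linear representation has vertex labeling $\mathcal{L}$. Then $$\sum_{\hat\pi\in LC_n(\mathcal{L})}x^{cr(\hat\pi)}y^{ne(\hat\pi)}=\sum_{\hat\pi\in LC_n(\mathcal{L})}x^{ne(\hat\pi)}y^{cr(\hat\pi)},$$ i.e. $cr$ and $ne$ have a symmetric joint distribution over $LC_n(\mathcal{L})$.
   Context: Two finite sets of integers $E,F$ are nearly disjoint if for every $i\in E\cap F$ either ($i=\min(E)$, $|E|>1$, $i\ne\min(F)$) or ($i=\min(F)$, $|F|>1$, $i\ne\min(E)$). A linked partition of $[n]$ is a set of nonempty subsets (blocks) of $[n]$ with union $[n]$, any two distinct blocks nearly disjoint; each element lies in one or two blocks (singly/doubly covered). A linked cycle on $[n]$ is a linked partition of $[n]$ with a cyclic arrangement of each block; a cycle is written $(i_1i_2\dots i_t)$ with $i_1$ its minimum. Linear representation of a linked cycle $\hat\pi$: for each $i\in[n]$ create vertices: if $i$ is singly covered and the minimum of its cycle, of size $k+1$, create $i^{(1)},\dots,i^{(k)}$ if $k\ge1$, and a single isolated vertex $i^{(1)}$ if $k=0$; if $i$ is singly covered and not the minimum of its cycle, create $i^{(0)}$; if $i$ is doubly covered and the minimum of a cycle of size $k+1$, create $i^{(0)},i^{(1)},\dots,i^{(k)}$. Vertices lie on a line ordered by $i$, then by superscript. For each cycle $(i_1\dots i_t)$, $t\ge2$, draw arcs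 $(i_1^{(j)},i_{t+1-j}^{(0)})$, $j=1,\dots,t-1$. The vertex labeling is the left-to-right sequence of vertex labels. A $k$-crossing is a set of $k$ arcs $(x_1,y_1),\dots,(x_k,y_k)$ whose endpoints appear in the order $x_1,\dots,x_k,y_1,\dots,y_k$; a $k$-nesting is one whose endpoints appear in the order $x_1,\dots,x_k,y_k,\dots,y_1$. $cr(\hat\pi)$ (resp. $ne(\hat\pi)$) is the largest $k$ such that $\hat\pi$ has a $k$-crossing (resp. $k$-nesting). *)

theory Defs
  imports Main "HOL-Library.Product_Lexorder"
begin

definition nearly_disjoint :: "nat set \<Rightarrow> nat set \<Rightarrow> bool" where
  "nearly_disjoint E F \<longleftrightarrow>
     (\<forall>i \<in> E \<inter> F. (i = Min E \<and> card E > 1 \<and> i \<noteq> Min F) \<or>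
                   (i = Min F \<and> card F > 1 \<and> i \<noteq> Min E))"

definition linked_partition :: "nat \<Rightarrow> nat set set \<Rightarrow> bool" where
  "linked_partition n P \<longleftrightarrow>
     (\<forall>B \<in> P. B \<noteq> {} \<and> B \<subseteq> {1..n}) \<and> \<Union>P = {1..n} \<and>
     (\<forall>E \<in> P. \<forall>F \<in> P. E \<noteq> F \<longrightarrow> nearly_disjoint E F) \<and>
     (\<forall>i \<in> {1..n}. card {B \<in> P. i \<in> B} \<in> {1, 2})"

text \<open>A cycle is written as a list (i_1 ... i_t) of distinct elements with i_1 its minimum.
  A linked cycle on [n] is a set of cycles whose underlying blocks form a linked
  partition of [n] (each block carrying exactly one cyclic arrangement).\<close>
definition linked_cycle :: "nat \<Rightarrow> nat list set \<Rightarrow> bool" where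
  "linked_cycle n C \<longleftrightarrow>
     finite C \<and>
     (\<forall>c \<in> C. c \<noteq> [] \<and> distinct c \<and> hd c = Min (set c)) \<and>
     inj_on set C \<and>
     linked_partition n (set ` C)"

definition cover_count :: "nat list set \<Rightarrow> nat \<Rightarrow> nat" where
  "cover_count C i = card {c \<in> C. i \<in> set c}"

text \<open>Vertices of the linear representation: vertex i^(j) is the pair (i, j);
  vertices are ordered lexicographically (by i, then by superscript).\<close>
definition lr_vertices :: "nat \<Rightarrow> nat list set \<Rightarrow> (nat \<times> nat) set" where
  "lr_vertices n C = {(i, j). i \<in> {1..n} \<and>
     (if cover_count C i = 1 then
        (if (\<exists>c \<in> C. hd c = i) then
           (let k = length (THE c. c \<in> C \<and> i \<in> set c) - 1 in
              if k \<ge> 1 then 1 \<le> j \<and> j \<le> k else j = 1)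
         else j = 0)
      else
        (\<exists>c \<in> C. hd c = i \<and> j \<le> length c - 1))}"

text \<open>Arcs (i_1^(j), i_(t+1-j)^(0)), j = 1..t-1, for each cycle (i_1 ... i_t), t >= 2.
  With 0-based list indexing, i_(t+1-j) is c ! (t - j).\<close>
definition lr_arcs :: "nat list set \<Rightarrow> ((nat \<times> nat) \<times> (nat \<times> nat)) set" where
  "lr_arcs C = {((hd c, j), (c ! (length c - j), 0)) | c j.
       c \<in> C \<and> length c \<ge> 2 \<and> 1 \<le> j \<and> j \<le> length c - 1}"

definition vertex_labeling :: "nat \<Rightarrow> nat list set \<Rightarrow> (nat \<times> nat) list" where
  "vertex_labeling n C = sorted_list_of_set (lr_vertices n C)"

definition has_k_crossing :: "(('v::linorder) \<times> 'v) set \<Rightarrow> nat \<Rightarrow> bool" where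
  "has_k_crossing A k \<longleftrightarrow> (\<exists>x y :: nat \<Rightarrow> 'v.
     (\<forall>m < k. (x m, y m) \<in> A) \<and>
     (\<forall>m. Suc m < k \<longrightarrow> x m < x (Suc m) \<and> y m < y (Suc m)) \<and>
     (0 < k \<longrightarrow> x (k - 1) < y 0))"

definition has_k_nesting :: "(('v::linorder) \<times> 'v) set \<Rightarrow> nat \<Rightarrow> bool" where
  "has_k_nesting A k \<longleftrightarrow> (\<exists>x y :: nat \<Rightarrow> 'v.
     (\<forall>m < k. (x m, y m) \<in> A) \<and>
     (\<forall>m. Suc m < k \<longrightarrow> x m < x (Suc m) \<and> y (Suc m) < y m) \<and>
     (0 < k \<longrightarrow> x (k - 1) < y (k - 1)))"

definition cr :: "nat list set \<Rightarrow> nat" where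
  "cr C = Max {k. has_k_crossing (lr_arcs C) k}"

definition ne :: "nat list set \<Rightarrow> nat" where
  "ne C = Max {k. has_k_nesting (lr_arcs C) k}"

definition LC :: "nat \<Rightarrow> (nat \<times> nat) list \<Rightarrow> nat list set set" where
  "LC n L = {C. linked_cycle n C \<and> vertex_labeling n C = L}"

end

theory Submission
  imports Defs
begin

text \<open>
  Arcs on a finite linearly ordered set of vertices are points of a staircase: an arc is placed in
  the column given by its opener, counted from the left, and the row given by its closer, counted
  from the right. Fomin's growth rule attaches a partition to every corner of the staircase. By
  Schensted's theorem the first row of the partition at a corner is the length of a longest
  north-east chain of the points below and to the left of it, and the number of rows that of a
  longest south-east chain; at the outer corners these chains are the nestings and the crossings,
  respectively, of arcs over a common point. The partitions on the boundary determine the points,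
  and transposing them all yields the boundary of another set of points. This is an involution on
  arc sets which exchanges crossings and nestings and keeps openers and closers. It acts on the
  linked cycles with a given vertex labeling, because replacing the arcs of a linked cycle by others
  with the same openers and closers merely permutes the non-minimal entries of the cycles.
\<close>

section \<open>Partitions\<close>

text \<open>Row lengths are indexed from 0; all rows beyond the last one have length 0.\<close>

definition is_partition :: "(nat \<Rightarrow> nat) \<Rightarrow> bool" where
  "is_partition f \<longleftrightarrow> antimono f \<and> finite {k. 0 < f k}"

definition add_box :: "nat \<Rightarrow> (nat \<Rightarrow> nat) \<Rightarrow> nat \<Rightarrow> nat" where
  "add_box k f = f(k := Suc (f k))"

definition box_step :: "(nat \<Rightarrow> nat) \<Rightarrow> (nat \<Rightarrow> nat) \<Rightarrow> bool" where
  "box_step f g \<longleftrightarrow> g = f \<or> (\<exists>k. g = add_box k f)"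

definition conjugate :: "(nat \<Rightarrow> nat) \<Rightarrow> nat \<Rightarrow> nat" where
  "conjugate f c = card {k. c < f k}"

lemma add_box_apply: "add_box k f i = (if i = k then Suc (f i) else f i)"
  by (simp add: add_box_def)

lemma add_box_neq [simp]: "add_box k f \<noteq> f" "f \<noteq> add_box k f"
  by (metis add_box_apply n_not_Suc_n)+

lemma add_box_commute: "add_box k (add_box l f) = add_box l (add_box k f)"
  by (auto simp: add_box_def)

lemma add_box_cancel: "add_box k f = add_box k g \<Longrightarrow> f = g"
  by (metis add_box_apply ext nat.inject)

lemma remove_boxE:
  assumes "0 < f k"
  obtains r where "f = add_box k r"
proof
  show "f = add_box k (f(k := f k - 1))"
    using assms by (auto simp: add_box_def)
qed

lemma add_box_eq_add_boxE:
  assumes "add_box k f = add_box l g" "k \<noteq> l"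
  obtains r where "f = add_box l r" "g = add_box k r"
proof -
  have "0 < f l"
    using assms by (metis add_box_apply zero_less_Suc)
  then obtain r where f: "f = add_box l r"
    by (rule remove_boxE)
  have "add_box l g = add_box l (add_box k r)"
    using assms(1) unfolding f by (simp add: add_box_commute)
  then show ?thesis
    using that f add_box_cancel by blast
qed

lemma box_step_refl [simp]: "box_step f f"
  and box_step_add_box [simp]: "box_step f (add_box k f)"
  by (auto simp: box_step_def)

lemma box_step_le: "box_step f g \<Longrightarrow> f k \<le> g k"
  by (auto simp: box_step_def add_box_apply)

lemma box_step_to_zero: "box_step f (\<lambda>_. 0) \<Longrightarrow> f = (\<lambda>_. 0)"
  by (meson box_step_le ext le_zero_eq)

lemma is_partition_zero [simp]: "is_partition (\<lambda>_. 0)"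
  by (simp add: is_partition_def antimono_def)

lemma is_partition_antimono: "is_partition f \<Longrightarrow> i \<le> j \<Longrightarrow> f j \<le> f i"
  by (simp add: is_partition_def antimonoD)

lemma is_partition_add_box_iff:
  assumes "is_partition f"
  shows "is_partition (add_box k f) \<longleftrightarrow> (\<forall>l. k = Suc l \<longrightarrow> f k < f l)"
proof -
  have "{i. 0 < add_box k f i} = insert k {i. 0 < f i}"
    by (auto simp: add_box_apply)
  then have "is_partition (add_box k f) \<longleftrightarrow> (\<forall>i. add_box k f (Suc i) \<le> add_box k f i)"
    using assms by (simp add: is_partition_def antimono_iff_le_Suc)
  moreover have "f (Suc i) \<le> f i" for i
    using assms is_partition_antimono by simp
  ultimately show ?thesis
    by (auto simp: add_box_apply le_Suc_eq Suc_le_eq)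
qed

lemma is_partition_remove_box:
  assumes "is_partition (add_box k f)" "f (Suc k) \<le> f k"
  shows "is_partition f"
proof -
  have "{i. 0 < f i} \<subseteq> {i. 0 < add_box k f i}"
    by (auto simp: add_box_apply)
  then have "finite {i. 0 < f i}"
    using assms(1) finite_subset unfolding is_partition_def by blast
  moreover have "f (Suc i) \<le> f i" for i
    using is_partition_antimono[OF assms(1), of i "Suc i"] assms(2)
    by (auto simp: add_box_apply split: if_splits)
  ultimately show ?thesis
    by (simp add: is_partition_def antimono_iff_le_Suc)
qed

lemma less_conjugate_iff:
  assumes "is_partition f"
  shows "k < conjugate f c \<longleftrightarrow> c < f k"
proof -
  define h where "h = (LEAST k. f k \<le> c)"
  have "\<exists>k. k \<notin> {k. 0 < f k}"
    using assms ex_new_if_finite[OF infinite_UNIV_nat] unfolding is_partition_def by blast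
  then have "\<exists>k. f k \<le> c" by (metis le0 mem_Collect_eq neq0_conv)
  then have "f h \<le> c"
    unfolding h_def by (rule LeastI_ex)
  have "{k. c < f k} = {..<h}"
  proof (intro set_eqI)
    fix k
    have "c < f k \<longleftrightarrow> k < h"
    proof (cases "k < h")
      case True
      then show ?thesis
        using not_less_Least unfolding h_def by force
    next
      case False
      then show ?thesis
        using is_partition_antimono[OF assms, of h k] \<open>f h \<le> c\<close> by simp
    qed
    then show "k \<in> {k. c < f k} \<longleftrightarrow> k \<in> {..<h}" by simp
  qed
  then show ?thesis
    unfolding conjugate_def by (metis card_lessThan lessThan_iff mem_Collect_eq)
qed

lemma is_partition_conjugate:
  assumes "is_partition f"
  shows "is_partition (conjugate f)"
proof -
  have "antimono (conjugate f)"
    unfolding antimono_iff_le_Suc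
    by (metis less_conjugate_iff[OF assms] Suc_lessD less_irrefl linorder_not_le)
  moreover have "{c. 0 < conjugate f c} = {..<f 0}"
    using less_conjugate_iff[OF assms] by auto
  ultimately show ?thesis
    by (simp add: is_partition_def)
qed

lemma conjugate_conjugate:
  assumes "is_partition f"
  shows "conjugate (conjugate f) = f"
proof
  fix k
  have "{c. k < conjugate f c} = {..<f k}"
    using less_conjugate_iff[OF assms] by auto
  then show "conjugate (conjugate f) k = f k"
    by (simp add: conjugate_def[of "conjugate f"])
qed

lemma conjugate_eq_iff:
  "is_partition f \<Longrightarrow> is_partition g \<Longrightarrow> conjugate f = conjugate g \<longleftrightarrow> f = g"
  by (metis conjugate_conjugate)

lemma conjugate_zero [simp]: "conjugate (\<lambda>_. 0) = (\<lambda>_. 0)"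
  by (simp add: conjugate_def fun_eq_iff)

lemma conjugate_add_box:
  assumes "is_partition f"
  shows "conjugate (add_box k f) = add_box (f k) (conjugate f)"
proof
  fix c
  have "{i. c < f i} = {..<conjugate f c}"
    using less_conjugate_iff[OF assms] by auto
  then have "finite {i. c < f i}" by simp
  moreover have "{i. c < add_box k f i} = (if c = f k then insert k {i. c < f i} else {i. c < f i})"
    by (auto simp: add_box_apply)
  ultimately show "conjugate (add_box k f) c = add_box (f k) (conjugate f) c"
    by (cases "c = f k") (simp_all add: conjugate_def add_box_apply[of "f k"])
qed

lemma box_step_conjugate: "is_partition f \<Longrightarrow> box_step f g \<Longrightarrow> box_step (conjugate f) (conjugate g)"
  by (auto simp: box_step_def conjugate_add_box)

section \<open>Fomin's local rule\<close>

text \<open>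
  A unit square has lower left corner \<open>r\<close>, lower right corner \<open>u\<close>, upper left corner \<open>v\<close> and upper
  right corner \<open>w\<close>; the Boolean says whether the square contains a point.
\<close>

inductive local_rule ::
  "(nat \<Rightarrow> nat) \<Rightarrow> (nat \<Rightarrow> nat) \<Rightarrow> (nat \<Rightarrow> nat) \<Rightarrow> (nat \<Rightarrow> nat) \<Rightarrow> bool \<Rightarrow> bool"
where
  point: "local_rule r r r (add_box 0 r) True"
| horizontal: "box_step r u \<Longrightarrow> local_rule r u r u False"
| vertical: "box_step r v \<Longrightarrow> local_rule r r v v False"
| bump: "local_rule r (add_box k r) (add_box k r) (add_box (Suc k) (add_box k r)) False"
| join: "k \<noteq> l \<Longrightarrow> local_rule r (add_box k r) (add_box l r) (add_box l (add_box k r)) False"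

text \<open>Row 0 receives a box from a point of the square, row \<open>Suc k\<close> one bumped out of row \<open>k\<close>.\<close>

primrec receives_box :: "(nat \<Rightarrow> nat) \<Rightarrow> (nat \<Rightarrow> nat) \<Rightarrow> (nat \<Rightarrow> nat) \<Rightarrow> bool \<Rightarrow> nat \<Rightarrow> bool" where
  "receives_box r u v m 0 \<longleftrightarrow> m"
| "receives_box r u v m (Suc k) \<longleftrightarrow> r k < min (u k) (v k)"

definition upper_corner ::
  "(nat \<Rightarrow> nat) \<Rightarrow> (nat \<Rightarrow> nat) \<Rightarrow> (nat \<Rightarrow> nat) \<Rightarrow> bool \<Rightarrow> nat \<Rightarrow> nat" where
  "upper_corner r u v m k = (if receives_box r u v m k then Suc (r k) else max (u k) (v k))"

definition lower_corner ::
  "(nat \<Rightarrow> nat) \<Rightarrow> (nat \<Rightarrow> nat) \<Rightarrow> (nat \<Rightarrow> nat) \<Rightarrow> nat \<Rightarrow> nat" where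
  "lower_corner u v w k =
     (if max (u (Suc k)) (v (Suc k)) < w (Suc k) then u k - 1 else min (u k) (v k))"

lemma local_rule_sym:
  assumes "local_rule r u v w m"
  shows "local_rule r v u w m"
  using assms
proof cases
  case (join k l)
  then show ?thesis
    using local_rule.join[of l k r] by (simp add: add_box_commute)
qed (auto intro: local_rule.intros)

lemma local_rule_box_step:
  assumes "local_rule r u v w m"
  shows "box_step r u" "box_step r v" "box_step u w" "box_step v w"
proof -
  have steps: "box_step r u \<and> box_step v w" if "local_rule r u v w m" for u v
    using that
  proof cases
    case (join k l)
    then show ?thesis by (simp add: add_box_commute[of l k])
  qed simp_all
  show "box_step r u" "box_step v w" "box_step r v" "box_step u w"
    using steps[OF assms] steps[OF local_rule_sym[OF assms]] by auto
qed

lemma local_rule_upper_eq_iff: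
  assumes "local_rule r u v w m"
  shows "w = v \<longleftrightarrow> u = r \<and> \<not> m"
  using assms
proof cases
  case (join k l)
  then show ?thesis by (simp add: add_box_commute[of l k])
qed auto

lemma local_rule_pointD: "local_rule r u v w True \<Longrightarrow> u = r"
  by (auto elim: local_rule.cases)

lemma local_rule_is_partition:
  assumes "local_rule r u v w m" "is_partition r" "is_partition u" "is_partition v"
  shows "is_partition w"
  using assms(1)
proof cases
  case (bump k)
  then show ?thesis
    using assms is_partition_antimono[OF assms(2), of k "Suc k"]
    by (simp add: is_partition_add_box_iff add_box_apply)
next
  case (join k l)
  then show ?thesis
    using assms by (auto simp: is_partition_add_box_iff add_box_apply)
qed (use assms in \<open>simp_all add: is_partition_add_box_iff\<close>)

lemma receives_box_iff:
  assumes "local_rule r u v w m"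
  shows "receives_box r u v m k \<longleftrightarrow> max (u k) (v k) < w k"
  using assms
  by cases (cases k; auto simp: add_box_apply dest: box_step_le[of _ _ k])+

lemma local_rule_upper_cornerD:
  assumes "local_rule r u v w m"
  shows "w = upper_corner r u v m"
proof
  fix k show "w k = upper_corner r u v m k"
    using assms unfolding upper_corner_def receives_box_iff[OF assms]
    by cases (auto simp: add_box_apply dest: box_step_le[of _ _ k])
qed

lemma local_rule_upper_corner:
  assumes "box_step r u" "box_step r v" "m \<Longrightarrow> u = r \<and> v = r"
  shows "local_rule r u v (upper_corner r u v m) m"
proof -
  consider (point) "m" "u = r" "v = r" | (horizontal) "\<not> m" "v = r" | (vertical) "\<not> m" "u = r"
    | (bump) k where "\<not> m" "u = add_box k r" "v = add_box k r"
    | (join) k l where "\<not> m" "u = add_box k r" "v = add_box l r" "k \<noteq> l"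
    using assms unfolding box_step_def by metis
  then have "\<exists>w. local_rule r u v w m"
    by cases (use assms local_rule.intros in \<open>simp; blast\<close>)+
  then show ?thesis
    using local_rule_upper_cornerD by blast
qed

lemma local_rule_lower_cornerD:
  assumes "local_rule r u v w m"
  shows "r = lower_corner u v w" "m \<longleftrightarrow> max (u 0) (v 0) < w 0"
proof -
  show "r = lower_corner u v w"
  proof
    fix k show "r k = lower_corner u v w k"
      using assms unfolding lower_corner_def receives_box_iff[OF assms, of "Suc k", symmetric]
      by cases (auto simp: add_box_apply dest: box_step_le[of _ _ k])
  qed
  show "m \<longleftrightarrow> max (u 0) (v 0) < w 0"
    using receives_box_iff[OF assms, of 0] by simp
qed

lemma local_rule_lower_exists_if_eq:
  assumes "is_partition u" "is_partition (add_box k u)"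
  shows "\<exists>r m. local_rule r u u (add_box k u) m \<and> is_partition r"
proof (cases k)
  case 0
  then show ?thesis using assms(1) local_rule.point by blast
next
  case (Suc l)
  then have "u (Suc l) < u l"
    using assms is_partition_add_box_iff by blast
  then obtain r where r: "u = add_box l r"
    using remove_boxE[of u l] by auto
  then have "r (Suc l) \<le> r l"
    using \<open>u (Suc l) < u l\<close> by (simp add: add_box_apply)
  then have "is_partition r"
    using assms(1) r is_partition_remove_box by blast
  then show ?thesis
    using local_rule.bump[of r l] r Suc by blast
qed

lemma local_rule_lower_exists_if_neq:
  assumes "is_partition u" "is_partition v" "add_box k u = add_box l v" "k \<noteq> l"
  shows "\<exists>r. local_rule r u v (add_box k u) False \<and> is_partition r"
proof -
  obtain r where r: "u = add_box l r" "v = add_box k r"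
    using assms(3,4) by (rule add_box_eq_add_boxE)
  have "r (Suc l) \<le> v (Suc l)" by (simp add: r add_box_apply)
  also have "\<dots> \<le> v l" using assms(2) is_partition_antimono by simp
  also have "\<dots> = r l" using assms(4) by (simp add: r add_box_apply)
  finally have "is_partition r"
    using assms(1) r is_partition_remove_box by blast
  then show ?thesis
    using local_rule.join[of l k r] assms(4) r by auto
qed

lemma local_rule_lower_corner:
  assumes "is_partition u" "is_partition v" "is_partition w" "box_step u w" "box_step v w"
  shows "local_rule (lower_corner u v w) u v w (max (u 0) (v 0) < w 0)"
    and "is_partition (lower_corner u v w)"
proof -
  consider (horizontal) "w = u" | (vertical) "w = v"
    | (eq) k where "w = add_box k u" "u = v"
    | (neq) k l where "w = add_box k u" "w = add_box l v" "k \<noteq> l"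
    using assms(4,5) unfolding box_step_def by (metis add_box_cancel)
  then have "\<exists>r m. local_rule r u v w m \<and> is_partition r"
  proof cases
    case horizontal
    then show ?thesis using local_rule.horizontal assms by blast
  next
    case vertical
    then show ?thesis using local_rule.vertical assms by blast
  next
    case eq
    then show ?thesis using local_rule_lower_exists_if_eq assms by blast
  next
    case neq
    then show ?thesis using local_rule_lower_exists_if_neq assms by metis
  qed
  then obtain r m where "local_rule r u v w m" "is_partition r" by blast
  then show "local_rule (lower_corner u v w) u v w (max (u 0) (v 0) < w 0)"
    and "is_partition (lower_corner u v w)"
    using local_rule_lower_cornerD[of r u v w m] by auto
qed

lemma local_rule_strip:
  assumes "P 0 = Q 0"
    and rule: "\<And>e. e < n \<Longrightarrow> local_rule (P e) (Q e) (P (Suc e)) (Q (Suc e)) (m e)"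
  shows "box_step (P n) (Q n)" "Q n = P n \<longleftrightarrow> (\<forall>e<n. \<not> m e)"
proof -
  have "box_step (P n) (Q n) \<and> (Q n = P n \<longleftrightarrow> (\<forall>e<n. \<not> m e))"
    using rule
  proof (induction n)
    case (Suc n)
    then have "local_rule (P n) (Q n) (P (Suc n)) (Q (Suc n)) (m n)" by simp
    then show ?case
      using Suc local_rule_box_step(4) local_rule_upper_eq_iff less_Suc_eq by metis
  qed (use assms(1) in simp)
  then show "box_step (P n) (Q n)" "Q n = P n \<longleftrightarrow> (\<forall>e<n. \<not> m e)" by auto
qed

lemma local_rule_strip_point_unique:
  assumes "P 0 = Q 0"
    and rule: "\<And>e. e < n \<Longrightarrow> local_rule (P e) (Q e) (P (Suc e)) (Q (Suc e)) (m e)"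
    and points: "e < n" "m e" "e' < n" "m e'"
  shows "e = e'"
proof -
  have "\<not> m e" if "e < e'" "e' < n" "m e'" for e e'
  proof -
    have "Q e' = P e'"
      using rule[OF \<open>e' < n\<close>] local_rule_pointD \<open>m e'\<close> by simp
    then show ?thesis
      using local_rule_strip(2)[of P Q e' m] assms(1) rule that by auto
  qed
  then show ?thesis using points by (metis linorder_neqE_nat)
qed

section \<open>Growth diagrams\<close>

definition matching :: "('a \<times> 'b) set \<Rightarrow> bool" where
  "matching A \<longleftrightarrow> inj_on fst A \<and> inj_on snd A"

lemma matching_fst_unique: "matching A \<Longrightarrow> (x, y) \<in> A \<Longrightarrow> (x, y') \<in> A \<Longrightarrow> y = y'"
  and matching_snd_unique: "matching A \<Longrightarrow> (x, y) \<in> A \<Longrightarrow> (x', y) \<in> A \<Longrightarrow> x = x'"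
  unfolding matching_def inj_on_def by fastforce+

lemma matchingI:
  assumes "\<And>x y y'. (x, y) \<in> A \<Longrightarrow> (x, y') \<in> A \<Longrightarrow> y = y'"
    and "\<And>x x' y. (x, y) \<in> A \<Longrightarrow> (x', y) \<in> A \<Longrightarrow> x = x'"
  shows "matching A"
  unfolding matching_def using assms by (auto intro!: inj_onI)

fun growth :: "(nat \<times> nat) set \<Rightarrow> nat \<Rightarrow> nat \<Rightarrow> nat \<Rightarrow> nat" where
  "growth P 0 d = (\<lambda>_. 0)"
| "growth P (Suc i) 0 = (\<lambda>_. 0)"
| "growth P (Suc i) (Suc d) =
     upper_corner (growth P i d) (growth P (Suc i) d) (growth P i (Suc d)) ((i, d) \<in> P)"

declare growth.simps(3) [simp del]

lemma growth_0_right [simp]: "growth P i 0 = (\<lambda>_. 0)"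
  by (cases i) simp_all

lemma growth_local_rule:
  assumes "matching P"
  shows "local_rule (growth P i d) (growth P (Suc i) d) (growth P i (Suc d))
    (growth P (Suc i) (Suc d)) ((i, d) \<in> P)"
proof (induction "i + d" arbitrary: i d rule: less_induct)
  case less
  have column: "local_rule (growth P i e) (growth P (Suc i) e) (growth P i (Suc e))
      (growth P (Suc i) (Suc e)) ((i, e) \<in> P)" if "e < d" for e
    by (rule less) (use that in simp)
  have row: "local_rule (growth P h d) (growth P h (Suc d)) (growth P (Suc h) d)
      (growth P (Suc h) (Suc d)) ((h, d) \<in> P)" if "h < i" for h
    by (rule local_rule_sym[OF less]) (use that in simp)
  have horizontal: "box_step (growth P i d) (growth P (Suc i) d)"
    "growth P (Suc i) d = growth P i d \<longleftrightarrow> (\<forall>e<d. (i, e) \<notin> P)"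
    using local_rule_strip[of "growth P i" "growth P (Suc i)" d "\<lambda>e. (i, e) \<in> P", OF _ column]
    by simp_all
  have vertical: "box_step (growth P i d) (growth P i (Suc d))"
    "growth P i (Suc d) = growth P i d \<longleftrightarrow> (\<forall>h<i. (h, d) \<notin> P)"
    using local_rule_strip[of "\<lambda>h. growth P h d" "\<lambda>h. growth P h (Suc d)" i "\<lambda>h. (h, d) \<in> P",
        OF _ row]
    by simp_all
  have "growth P (Suc i) d = growth P i d \<and> growth P i (Suc d) = growth P i d" if "(i, d) \<in> P"
    unfolding horizontal(2) vertical(2)
    using matching_fst_unique[OF assms that] matching_snd_unique[OF assms that]
    by (metis less_irrefl)
  then show ?case
    using local_rule_upper_corner horizontal(1) vertical(1) by (simp add: growth.simps(3))
qed

lemma is_partition_growth: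
  assumes "matching P"
  shows "is_partition (growth P i d)"
  using assms
proof (induction P i d rule: growth.induct)
  case (3 P i d)
  then show ?case
    using local_rule_is_partition growth_local_rule by blast
qed simp_all

lemma growth_step_right:
  assumes "matching P"
  shows "box_step (growth P i d) (growth P (Suc i) d)"
    and "growth P (Suc i) d = growth P i d \<longleftrightarrow> (\<forall>e<d. (i, e) \<notin> P)"
  using local_rule_strip[of "growth P i" "growth P (Suc i)" d "\<lambda>e. (i, e) \<in> P"]
    growth_local_rule[OF assms] by simp_all

lemma growth_step_up:
  assumes "matching P"
  shows "box_step (growth P i d) (growth P i (Suc d))"
    and "growth P i (Suc d) = growth P i d \<longleftrightarrow> (\<forall>h<i. (h, d) \<notin> P)"
  using local_rule_strip[of "\<lambda>h. growth P h d" "\<lambda>h. growth P h (Suc d)" i "\<lambda>h. (h, d) \<in> P"]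
    local_rule_sym[OF growth_local_rule[OF assms]] by simp_all

section \<open>Chains\<close>

definition has_chain :: "('a \<Rightarrow> 'a \<Rightarrow> bool) \<Rightarrow> 'a set \<Rightarrow> nat \<Rightarrow> bool" where
  "has_chain R A n \<longleftrightarrow> (\<exists>ps. length ps = n \<and> set ps \<subseteq> A \<and> sorted_wrt R ps)"

definition north_east :: "'a::linorder \<times> 'b::linorder \<Rightarrow> 'a \<times> 'b \<Rightarrow> bool" where
  "north_east p q \<longleftrightarrow> fst p < fst q \<and> snd p < snd q"

definition south_east :: "'a::linorder \<times> 'b::linorder \<Rightarrow> 'a \<times> 'b \<Rightarrow> bool" where
  "south_east p q \<longleftrightarrow> fst p < fst q \<and> snd q < snd p"

lemma transp_north_east: "transp north_east" and transp_south_east: "transp south_east"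
  by (auto intro!: transpI simp: north_east_def south_east_def)

lemma has_chain_0 [simp]: "has_chain R A 0"
  by (simp add: has_chain_def)

lemma has_chain_Suc_iff:
  "has_chain R A (Suc n) \<longleftrightarrow> (\<exists>p ps. length ps = n \<and> set (p # ps) \<subseteq> A \<and> sorted_wrt R (p # ps))"
  unfolding has_chain_def length_Suc_conv by blast

lemma has_chain_1: "has_chain R A (Suc 0) \<longleftrightarrow> A \<noteq> {}"
  by (auto simp: has_chain_Suc_iff)

lemma has_chain_mono: "has_chain R A n \<Longrightarrow> A \<subseteq> B \<Longrightarrow> has_chain R B n"
  unfolding has_chain_def by blast

lemma has_chain_le:
  assumes "has_chain R A n" "m \<le> n"
  shows "has_chain R A m"
proof -
  obtain ps where ps: "length ps = n" "set ps \<subseteq> A" "sorted_wrt R ps"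
    using assms(1) unfolding has_chain_def by blast
  then have "length (take m ps) = m \<and> set (take m ps) \<subseteq> A \<and> sorted_wrt R (take m ps)"
    using assms(2) set_take_subset[of m ps] by (auto simp: sorted_wrt_take)
  then show ?thesis
    unfolding has_chain_def by blast
qed

lemma has_chain_insert:
  assumes "has_chain R A n" "\<And>q. q \<in> A \<Longrightarrow> R q p"
  shows "has_chain R (insert p A) (Suc n)"
proof -
  obtain ps where "length ps = n" "set ps \<subseteq> A" "sorted_wrt R ps"
    using assms(1) unfolding has_chain_def by blast
  then have "length (ps @ [p]) = Suc n \<and> set (ps @ [p]) \<subseteq> insert p A \<and> sorted_wrt R (ps @ [p])"
    using assms(2) by (auto simp: sorted_wrt_append)
  then show ?thesis
    unfolding has_chain_def by blast
qed

lemma has_chain_image_iff: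
  assumes "\<And>p q. p \<in> A \<Longrightarrow> q \<in> A \<Longrightarrow> R (f p) (f q) \<longleftrightarrow> R' p q"
  shows "has_chain R (f ` A) n \<longleftrightarrow> has_chain R' A n"
proof -
  have "sorted_wrt R (map f ps) \<longleftrightarrow> sorted_wrt R' ps" if "set ps \<subseteq> A" for ps
    unfolding sorted_wrt_map using that assms by (auto elim!: sorted_wrt_mono_rel[rotated])
  moreover have "set qs \<subseteq> f ` A \<longleftrightarrow> (\<exists>ps. set ps \<subseteq> A \<and> qs = map f ps)" for qs
    using lists_image[of f A] by (auto simp: lists_eq_set image_iff set_eq_iff)
  ultimately show ?thesis
    unfolding has_chain_def by (metis length_map)
qed

lemma has_chain_iff_fun:
  assumes "transp R"
  shows "has_chain R A (Suc n) \<longleftrightarrow> (\<exists>f. (\<forall>m\<le>n. f m \<in> A) \<and> (\<forall>m<n. R (f m) (f (Suc m))))"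
proof
  assume "has_chain R A (Suc n)"
  then obtain ps where "length ps = Suc n" "set ps \<subseteq> A" "sorted_wrt R ps"
    unfolding has_chain_def by blast
  then show "\<exists>f. (\<forall>m\<le>n. f m \<in> A) \<and> (\<forall>m<n. R (f m) (f (Suc m)))"
    by (intro exI[of _ "nth ps"]) (auto simp: sorted_wrt_nth_less)
next
  assume "\<exists>f. (\<forall>m\<le>n. f m \<in> A) \<and> (\<forall>m<n. R (f m) (f (Suc m)))"
  then obtain f where "\<forall>m\<le>n. f m \<in> A" "\<forall>m<n. R (f m) (f (Suc m))" by blast
  then show "has_chain R A (Suc n)"
    unfolding has_chain_def using assms
    by (intro exI[of _ "map f [0..<Suc n]"])
      (auto simp: sorted_wrt_iff_nth_Suc_transp less_Suc_eq_le simp del: upt_Suc)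
qed

section \<open>Viennot's shadow lines\<close>

text \<open>
  \<open>r i d\<close> counts the shadow lines of the points \<open>M\<close> that meet the rectangle with upper right corner
  \<open>(i, d)\<close>. Each point emits a line to the right and one upwards; these travel straight on, and
  where two of them meet, both end at a point of the skeleton \<open>S\<close>.
\<close>

inductive shadow_rule :: "nat \<Rightarrow> nat \<Rightarrow> nat \<Rightarrow> nat \<Rightarrow> bool \<Rightarrow> bool \<Rightarrow> bool" where
  emit: "shadow_rule r r r (Suc r) True False"
| meet: "shadow_rule r (Suc r) (Suc r) (Suc r) False True"
| pass_up: "u = r \<or> u = Suc r \<Longrightarrow> shadow_rule r u r u False False"
| pass_right: "v = r \<or> v = Suc r \<Longrightarrow> shadow_rule r r v v False False"

locale shadow_lines =
  fixes r :: "nat \<Rightarrow> nat \<Rightarrow> nat" and M S :: "(nat \<times> nat) set"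
  assumes zero_left: "r 0 d = 0"
    and zero_bottom: "r i 0 = 0"
    and rule: "shadow_rule (r i d) (r (Suc i) d) (r i (Suc d)) (r (Suc i) (Suc d))
      ((i, d) \<in> M) ((i, d) \<in> S)"

definition vertical_step :: "(nat \<Rightarrow> nat \<Rightarrow> nat) \<Rightarrow> nat \<Rightarrow> nat \<Rightarrow> bool" where
  "vertical_step r i d \<longleftrightarrow> r i (Suc d) = Suc (r i d)"

definition horizontal_step :: "(nat \<Rightarrow> nat \<Rightarrow> nat) \<Rightarrow> nat \<Rightarrow> nat \<Rightarrow> bool" where
  "horizontal_step r i d \<longleftrightarrow> r (Suc i) d = Suc (r i d)"

lemma shadow_rule_sym: "shadow_rule r u v w m s \<Longrightarrow> shadow_rule r v u w m s"
  by (auto elim!: shadow_rule.cases intro: shadow_rule.intros)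

lemma shadow_lines_converse:
  "shadow_lines r M S \<Longrightarrow> shadow_lines (\<lambda>i d. r d i) (M\<inverse>) (S\<inverse>)"
  unfolding shadow_lines_def by (simp add: shadow_rule_sym)

lemma vertical_step_transpose: "vertical_step (\<lambda>i d. r d i) i d \<longleftrightarrow> horizontal_step r d i"
  by (simp add: vertical_step_def horizontal_step_def)

context shadow_lines
begin

lemma point_iff: "(i, d) \<in> M \<longleftrightarrow> vertical_step r (Suc i) d \<and> horizontal_step r i (Suc d)"
  and skeleton_iff: "(i, d) \<in> S \<longleftrightarrow> vertical_step r i d \<and> horizontal_step r i d"
  and vertical_step_Suc_iff:
    "vertical_step r (Suc i) d \<longleftrightarrow> vertical_step r i d \<and> (i, d) \<notin> S \<or> (i, d) \<in> M"
  unfolding vertical_step_def horizontal_step_def using rule[of i d] by (cases; auto)+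

lemma point_Suc: "(i, d) \<in> M \<Longrightarrow> r (Suc i) (Suc d) = Suc (r i d)"
  and not_point_max: "(i, d) \<notin> M \<Longrightarrow> r (Suc i) (Suc d) = max (r (Suc i) d) (r i (Suc d))"
  using rule[of i d] by (cases; auto)+

lemma vertical_step_right:
  assumes "vertical_step r i d" "i \<le> i'"
  shows "vertical_step r i' d \<or> (\<exists>p\<ge>i. p < i' \<and> (p, d) \<in> S)"
  using assms(2)
proof (induction rule: dec_induct)
  case (step p)
  then show ?case using vertical_step_Suc_iff less_Suc_eq by blast
qed (use assms(1) in simp)

lemma vertical_step_left:
  assumes "vertical_step r i' d" "i \<le> i'"
  shows "vertical_step r i d \<or> (\<exists>p\<ge>i. p < i' \<and> (p, d) \<in> M)"
  using assms(2)
proof (induction rule: inc_induct)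
  case (step p)
  then show ?case using vertical_step_Suc_iff[of p d] Suc_leD order_refl by metis
qed (use assms(1) in simp)

lemma horizontal_step_up:
  assumes "horizontal_step r i d" "d \<le> d'"
  shows "horizontal_step r i d' \<or> (\<exists>q\<ge>d. q < d' \<and> (i, q) \<in> S)"
  using shadow_lines.vertical_step_right[OF shadow_lines_converse[OF shadow_lines_axioms]] assms
  by (simp add: vertical_step_transpose)

lemma horizontal_step_down:
  assumes "horizontal_step r i d'" "d \<le> d'"
  shows "horizontal_step r i d \<or> (\<exists>q\<ge>d. q < d' \<and> (i, q) \<in> M)"
  using shadow_lines.vertical_step_left[OF shadow_lines_converse[OF shadow_lines_axioms]] assms
  by (simp add: vertical_step_transpose)

lemma count_mono: "i \<le> i' \<Longrightarrow> d \<le> d' \<Longrightarrow> r i d \<le> r i' d'"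
proof -
  have "r i d \<le> r (Suc i) d" for i d
    using rule[of i "d - 1"] zero_bottom by (cases d) (auto elim: shadow_rule.cases)
  moreover have "r i d \<le> r i (Suc d)" for i d
    using rule[of "i - 1" d] zero_left by (cases i) (auto elim: shadow_rule.cases)
  ultimately show "i \<le> i' \<Longrightarrow> d \<le> d' \<Longrightarrow> r i d \<le> r i' d'"
    using lift_Suc_mono_le[of "\<lambda>i. r i d"] lift_Suc_mono_le[of "r i'"] order_trans by metis
qed

lemma north_east_chain_length_le:
  assumes "sorted_wrt north_east ps" "set ps \<subseteq> M \<inter> {..<i} \<times> {..<d}"
  shows "length ps \<le> r i d"
  using assms
proof (induction ps arbitrary: i d rule: rev_induct)
  case (snoc p ps)
  obtain a b where p: "p = (a, b)" by (cases p)
  have "set ps \<subseteq> M \<inter> {..<a} \<times> {..<b}"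
    using snoc.prems by (auto simp: p sorted_wrt_append north_east_def)
  then have "length (ps @ [p]) \<le> r (Suc a) (Suc b)"
    using snoc point_Suc[of a b] by (auto simp: p sorted_wrt_append)
  also have "\<dots> \<le> r i d"
    using snoc.prems by (intro count_mono) (auto simp: p)
  finally show ?case .
qed simp

lemma has_north_east_chain: "has_chain north_east (M \<inter> {..<i} \<times> {..<d}) (r i d)"
proof (induction i arbitrary: d)
  case (Suc i)
  note left_chain = Suc.IH
  show ?case
  proof (induction d)
    case (Suc d)
    show ?case
    proof (cases "(i, d) \<in> M")
      case True
      have "has_chain north_east (insert (i, d) (M \<inter> {..<i} \<times> {..<d})) (Suc (r i d))"
        by (rule has_chain_insert[OF left_chain]) (auto simp: north_east_def)
      then show ?thesis
        using True by (auto simp: point_Suc elim: has_chain_mono)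
    next
      case False
      then have "r (Suc i) (Suc d) = r (Suc i) d \<or> r (Suc i) (Suc d) = r i (Suc d)"
        by (auto simp: not_point_max max_def)
      then show ?thesis
        using Suc.IH left_chain[of "Suc d"] by (auto elim!: has_chain_mono)
    qed
  qed (simp add: zero_bottom)
qed (simp add: zero_left)

lemma has_north_east_chain_iff:
  "has_chain north_east (M \<inter> {..<i} \<times> {..<d}) n \<longleftrightarrow> n \<le> r i d"
  using north_east_chain_length_le has_chain_le[OF has_north_east_chain]
  unfolding has_chain_def by blast

lemma skeleton_between:
  assumes "(a, b) \<in> M" "(a', b') \<in> M" "a < a'" "b' < b"
  shows "\<exists>p q. (p, q) \<in> S \<and> a < p \<and> p \<le> a' \<and> b' < q \<and> q \<le> b"
proof -
  have "vertical_step r (Suc a) b" "horizontal_step r a' (Suc b')"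
    using assms(1,2) by (simp_all add: point_iff)
  then consider p where "Suc a \<le> p" "p < a'" "(p, b) \<in> S"
    | q where "Suc b' \<le> q" "q < b" "(a', q) \<in> S" | "(a', b) \<in> S"
    using vertical_step_right[of "Suc a" b a'] horizontal_step_up[of a' "Suc b'" b] assms(3,4)
    by (auto simp: skeleton_iff)
  then show ?thesis
    using assms(3,4) by cases (auto simp: Suc_le_eq intro: less_imp_le)
qed

lemma point_between:
  assumes "(a, b) \<in> S" "(a', b') \<in> S" "a < a'" "b' < b"
  shows "\<exists>p q. (p, q) \<in> M \<and> a \<le> p \<and> p < a' \<and> b' \<le> q \<and> q < b"
proof -
  have "vertical_step r a' b'" "horizontal_step r a b"
    using assms(1,2) by (simp_all add: skeleton_iff)
  then consider p where "Suc a \<le> p" "p < a'" "(p, b') \<in> M"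
    | q where "Suc b' \<le> q" "q < b" "(a, q) \<in> M" | "(a, b') \<in> M"
    using vertical_step_left[of a' b' "Suc a"] horizontal_step_down[of a b "Suc b'"] assms(3,4)
    by (auto simp: point_iff)
  then show ?thesis
    using assms(3,4) by cases (auto simp: Suc_le_eq intro: less_imp_le)
qed

lemma point_left: "(a, b) \<in> S \<Longrightarrow> \<exists>p<a. (p, b) \<in> M"
  using vertical_step_left[of a b 0] by (auto simp: skeleton_iff vertical_step_def zero_left)

lemma point_below: "(a, b) \<in> S \<Longrightarrow> \<exists>q<b. (a, q) \<in> M"
  using shadow_lines.point_left[OF shadow_lines_converse[OF shadow_lines_axioms]] by simp

text \<open>
  The points found between consecutive members of a chain lie in half-open boxes which are
  themselves in south-east position, so they form a chain again.
\<close>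

lemma skeleton_chain:
  assumes "sorted_wrt south_east (p # ps)" "set (p # ps) \<subseteq> M \<inter> {..<i} \<times> {..<d}"
  shows "\<exists>qs. length qs = length ps \<and> set qs \<subseteq> S \<inter> {..<i} \<times> {..<d} \<and> sorted_wrt south_east qs \<and>
    (\<forall>q\<in>set qs. fst p < fst q \<and> snd q \<le> snd p)"
  using assms
proof (induction ps arbitrary: p)
  case (Cons p' ps)
  then obtain qs where qs: "length qs = length ps" "set qs \<subseteq> S \<inter> {..<i} \<times> {..<d}"
    "sorted_wrt south_east qs" "\<forall>q\<in>set qs. fst p' < fst q \<and> snd q \<le> snd p'"
    by (metis list.set_intros(2) set_subset_Cons sorted_wrt.simps(2) subset_trans)
  have pp': "south_east p p'" "p \<in> M" "p' \<in> M" "p \<in> {..<i} \<times> {..<d}" "p' \<in> {..<i} \<times> {..<d}"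
    using Cons.prems by auto
  then obtain q where q: "q \<in> S" "fst p < fst q" "fst q \<le> fst p'" "snd p' < snd q" "snd q \<le> snd p"
    using skeleton_between[of "fst p" "snd p" "fst p'" "snd p'"] by (auto simp: south_east_def)
  have "south_east q x" "fst p < fst x \<and> snd x \<le> snd p" if "x \<in> set qs" for x
    using qs(4) that q pp'(1) by (force simp: south_east_def)+
  moreover have "q \<in> {..<i} \<times> {..<d}"
    using q pp'(4,5) by (auto simp: mem_Times_iff)
  ultimately show ?case
    using qs q by (intro exI[of _ "q # qs"]) simp
qed simp

lemma point_chain:
  assumes "sorted_wrt south_east (q # qs)" "set (q # qs) \<subseteq> S \<inter> {..<i} \<times> {..<d}"
  shows "\<exists>ps. length ps = Suc (length qs) \<and> set ps \<subseteq> M \<inter> {..<i} \<times> {..<d} \<and>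
    sorted_wrt south_east ps \<and> (\<forall>p\<in>set ps. fst q \<le> fst p \<and> snd p < snd q)"
  using assms
proof (induction qs arbitrary: q)
  case Nil
  then obtain b where "(fst q, b) \<in> M" "b < snd q"
    using point_below[of "fst q" "snd q"] by auto
  then show ?case
    using Nil by (intro exI[of _ "[(fst q, b)]"]) (auto simp: mem_Times_iff)
next
  case (Cons q' qs)
  then obtain ps where ps: "length ps = Suc (length qs)" "set ps \<subseteq> M \<inter> {..<i} \<times> {..<d}"
    "sorted_wrt south_east ps" "\<forall>p\<in>set ps. fst q' \<le> fst p \<and> snd p < snd q'"
    by (metis list.set_intros(2) set_subset_Cons sorted_wrt.simps(2) subset_trans)
  have qq': "south_east q q'" "q \<in> S" "q' \<in> S" "q \<in> {..<i} \<times> {..<d}" "q' \<in> {..<i} \<times> {..<d}"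
    using Cons.prems by auto
  then obtain p where p: "p \<in> M" "fst q \<le> fst p" "fst p < fst q'" "snd q' \<le> snd p" "snd p < snd q"
    using point_between[of "fst q" "snd q" "fst q'" "snd q'"] by (auto simp: south_east_def)
  have "south_east p x" "fst q \<le> fst x \<and> snd x < snd q" if "x \<in> set ps" for x
    using ps(4) that p qq'(1) by (force simp: south_east_def)+
  moreover have "p \<in> {..<i} \<times> {..<d}"
    using p qq'(4,5) by (auto simp: mem_Times_iff)
  ultimately show ?case
    using ps p by (intro exI[of _ "p # ps"]) simp
qed

lemma has_south_east_chain_iff_skeleton:
  "has_chain south_east (M \<inter> {..<i} \<times> {..<d}) (Suc (Suc n)) \<longleftrightarrow>
    has_chain south_east (S \<inter> {..<i} \<times> {..<d}) (Suc n)"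
proof
  assume "has_chain south_east (M \<inter> {..<i} \<times> {..<d}) (Suc (Suc n))"
  then obtain p ps where p: "length ps = Suc n" "set (p # ps) \<subseteq> M \<inter> {..<i} \<times> {..<d}"
    "sorted_wrt south_east (p # ps)"
    unfolding has_chain_Suc_iff by blast
  show "has_chain south_east (S \<inter> {..<i} \<times> {..<d}) (Suc n)"
    using skeleton_chain[OF p(3,2)] p(1) unfolding has_chain_def by auto
next
  assume "has_chain south_east (S \<inter> {..<i} \<times> {..<d}) (Suc n)"
  then obtain q qs where q: "length qs = n" "set (q # qs) \<subseteq> S \<inter> {..<i} \<times> {..<d}"
    "sorted_wrt south_east (q # qs)"
    unfolding has_chain_Suc_iff by blast
  obtain ps where ps: "length ps = Suc n" "set ps \<subseteq> M \<inter> {..<i} \<times> {..<d}"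
    "sorted_wrt south_east ps" "\<forall>p\<in>set ps. fst q \<le> fst p \<and> snd p < snd q"
    using point_chain[OF q(3,2)] q(1) by auto
  obtain a where "(a, snd q) \<in> M" "a < fst q"
    using point_left[of "fst q" "snd q"] q(2) by auto
  then show "has_chain south_east (M \<inter> {..<i} \<times> {..<d}) (Suc (Suc n))"
    unfolding has_chain_def using ps q(2)
    by (intro exI[of _ "(a, snd q) # ps"]) (auto simp: south_east_def mem_Times_iff)
qed

end

section \<open>Schensted's theorem\<close>

definition layer :: "(nat \<times> nat) set \<Rightarrow> nat \<Rightarrow> (nat \<times> nat) set" where
  "layer P k = {(i, d).
     receives_box (growth P i d) (growth P (Suc i) d) (growth P i (Suc d)) ((i, d) \<in> P) k}"

lemma layer_0 [simp]: "layer P 0 = P"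
  by (auto simp: layer_def)

lemma local_rule_shadow_rule:
  assumes "local_rule r u v w m"
  shows "shadow_rule (r k) (u k) (v k) (w k)
    (receives_box r u v m k) (receives_box r u v m (Suc k))"
  using assms
  by cases (cases k; auto simp: box_step_def add_box_apply intro: shadow_rule.intros)+

lemma shadow_lines_growth:
  assumes "matching P"
  shows "shadow_lines (\<lambda>i d. growth P i d k) (layer P k) (layer P (Suc k))"
  using local_rule_shadow_rule[OF growth_local_rule[OF assms]]
  unfolding shadow_lines_def layer_def by simp

theorem growth_row_iff:
  assumes "matching P"
  shows "has_chain north_east (P \<inter> {..<i} \<times> {..<d}) n \<longleftrightarrow> n \<le> growth P i d 0"
  using shadow_lines.has_north_east_chain_iff[OF shadow_lines_growth[OF assms, of 0]] by simp

theorem growth_column_iff: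
  assumes "matching P"
  shows "has_chain south_east (P \<inter> {..<i} \<times> {..<d}) n \<longleftrightarrow> n \<le> conjugate (growth P i d) 0"
proof (cases n)
  case (Suc m)
  note shadow = shadow_lines_growth[OF assms]
  have "has_chain south_east (layer P k \<inter> {..<i} \<times> {..<d}) (Suc m) \<longleftrightarrow> 0 < growth P i d (k + m)" for k
  proof (induction m arbitrary: k)
    case 0
    then show ?case
      using shadow_lines.has_north_east_chain_iff[OF shadow, of k i d "Suc 0"]
      by (simp add: has_chain_1 Suc_le_eq)
  next
    case (Suc m)
    then show ?case
      by (simp add: shadow_lines.has_south_east_chain_iff_skeleton[OF shadow])
  qed
  from this[of 0] show ?thesis
    by (simp add: Suc Suc_le_eq less_conjugate_iff is_partition_growth assms)
qed simp

section \<open>Transposing the boundary of a staircase\<close>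

definition staircase :: "nat \<Rightarrow> (nat \<times> nat) set" where
  "staircase N = {(i, d). Suc (i + d) < N}"

text \<open>
  The boundary of the staircase consists of the corners \<open>(i, d)\<close> with \<open>i + d \<in> {N - 1, N}\<close>; the
  partitions \<open>c\<close> there are extended to the corners below by running the local rule backwards.
\<close>

function backfill :: "nat \<Rightarrow> (nat \<Rightarrow> nat \<Rightarrow> nat \<Rightarrow> nat) \<Rightarrow> nat \<Rightarrow> nat \<Rightarrow> nat \<Rightarrow> nat" where
  "backfill N c i d = (if N \<le> Suc (i + d) then c i d
     else lower_corner (backfill N c (Suc i) d) (backfill N c i (Suc d))
       (backfill N c (Suc i) (Suc d)))"
  by auto
termination
  by (relation "measure (\<lambda>(N, c, i, d). N - (i + d))") auto

declare backfill.simps [simp del]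

lemma backfill_boundary: "N \<le> Suc (i + d) \<Longrightarrow> backfill N c i d = c i d"
  by (simp add: backfill.simps)

lemma backfill_inside:
  "Suc (i + d) < N \<Longrightarrow> backfill N c i d =
     lower_corner (backfill N c (Suc i) d) (backfill N c i (Suc d)) (backfill N c (Suc i) (Suc d))"
  by (subst backfill.simps) simp

definition filling :: "nat \<Rightarrow> (nat \<Rightarrow> nat \<Rightarrow> nat \<Rightarrow> nat) \<Rightarrow> (nat \<times> nat) set" where
  "filling N F = {(i, d) \<in> staircase N. max (F (Suc i) d 0) (F i (Suc d) 0) < F (Suc i) (Suc d) 0}"

lemma backfill_eq_growth:
  assumes "matching P" "i + d \<le> N"
    and boundary: "\<And>i d. i + d \<le> N \<Longrightarrow> N \<le> Suc (i + d) \<Longrightarrow> c i d = growth P i d"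
  shows "backfill N c i d = growth P i d"
  using assms(2)
proof (induction "N - (i + d)" arbitrary: i d rule: less_induct)
  case less
  show ?case
  proof (cases "Suc (i + d) < N")
    case True
    then show ?thesis
      using less local_rule_lower_cornerD(1)[OF growth_local_rule[OF assms(1)], of i d]
      by (simp add: backfill_inside)
  next
    case False
    then show ?thesis
      using less.prems boundary by (simp add: backfill_boundary)
  qed
qed

lemma filling_backfill:
  assumes "matching P" "P \<subseteq> staircase N"
    and boundary: "\<And>i d. i + d \<le> N \<Longrightarrow> N \<le> Suc (i + d) \<Longrightarrow> c i d = growth P i d"
  shows "filling N (backfill N c) = P"
proof -
  have "(i, d) \<in> filling N (backfill N c) \<longleftrightarrow> (i, d) \<in> P" if "(i, d) \<in> staircase N" for i d
    using that local_rule_lower_cornerD(2)[OF growth_local_rule[OF assms(1)], of i d]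
    by (simp add: filling_def staircase_def backfill_eq_growth[OF assms(1) _ boundary])
  then show ?thesis
    using assms(2) by (auto simp: filling_def)
qed

locale staircase_boundary =
  fixes N :: nat and c :: "nat \<Rightarrow> nat \<Rightarrow> nat \<Rightarrow> nat"
  assumes partition: "i + d \<le> N \<Longrightarrow> N \<le> Suc (i + d) \<Longrightarrow> is_partition (c i d)"
    and step_right: "Suc (i + d) = N \<Longrightarrow> box_step (c i d) (c (Suc i) d)"
    and step_up: "Suc (i + d) = N \<Longrightarrow> box_step (c i d) (c i (Suc d))"
    and zero_left: "c 0 N = (\<lambda>_. 0)"
    and zero_bottom: "c N 0 = (\<lambda>_. 0)"
begin

lemma is_partition_and_box_step_backfill:
  assumes "i + d \<le> N"
  shows "is_partition (backfill N c i d) \<and> (i + d < N \<longrightarrow>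
    box_step (backfill N c i d) (backfill N c (Suc i) d) \<and>
    box_step (backfill N c i d) (backfill N c i (Suc d)))"
  using assms
proof (induction "N - (i + d)" arbitrary: i d rule: less_induct)
  case less
  show ?case
  proof (cases "Suc (i + d) < N")
    case True
    let ?u = "backfill N c (Suc i) d" and ?v = "backfill N c i (Suc d)"
    let ?w = "backfill N c (Suc i) (Suc d)"
    have "is_partition ?u" "is_partition ?v" "is_partition ?w" "box_step ?u ?w" "box_step ?v ?w"
      using less.hyps[of "Suc i" d] less.hyps[of i "Suc d"] less.hyps[of "Suc i" "Suc d"] True
      by auto
    note corner = local_rule_lower_corner[OF this]
    show ?thesis
      unfolding backfill_inside[OF True]
      using corner local_rule_box_step(1,2)[OF corner(1)] by blast
  next
    case False
    then show ?thesis
      using less.prems partition step_right step_up by (simp add: backfill_boundary)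
  qed
qed

lemma local_rule_backfill:
  assumes "Suc (i + d) < N"
  shows "local_rule (backfill N c i d) (backfill N c (Suc i) d) (backfill N c i (Suc d))
    (backfill N c (Suc i) (Suc d)) ((i, d) \<in> filling N (backfill N c))"
proof -
  have point: "(i, d) \<in> filling N (backfill N c) \<longleftrightarrow>
      max (backfill N c (Suc i) d 0) (backfill N c i (Suc d) 0) < backfill N c (Suc i) (Suc d) 0"
    using assms by (simp add: filling_def staircase_def)
  show ?thesis
    unfolding backfill_inside[OF assms] point
    using is_partition_and_box_step_backfill[of "Suc i" d]
      is_partition_and_box_step_backfill[of i "Suc d"]
      is_partition_and_box_step_backfill[of "Suc i" "Suc d"] assms
    by (intro local_rule_lower_corner(1)) simp_all
qed

lemma backfill_left: "d \<le> N \<Longrightarrow> backfill N c 0 d = (\<lambda>_. 0)"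
proof (induction rule: inc_induct)
  case (step d)
  then show ?case using is_partition_and_box_step_backfill[of 0 d] box_step_to_zero by simp
qed (simp add: backfill_boundary zero_left)

lemma backfill_bottom: "i \<le> N \<Longrightarrow> backfill N c i 0 = (\<lambda>_. 0)"
proof (induction rule: inc_induct)
  case (step i)
  then show ?case using is_partition_and_box_step_backfill[of i 0] box_step_to_zero by simp
qed (simp add: backfill_boundary zero_bottom)

lemma matching_filling_backfill: "matching (filling N (backfill N c))"
proof (rule matchingI)
  let ?E = "backfill N c" and ?P = "filling N (backfill N c)"
  have rule: "local_rule (?E i d) (?E (Suc i) d) (?E i (Suc d)) (?E (Suc i) (Suc d)) ((i, d) \<in> ?P)"
    if "Suc (i + d) < N" for i d
    using that by (rule local_rule_backfill)
  have inside: "Suc (i + d) < N" if "(i, d) \<in> ?P" for i d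
    using that by (simp add: filling_def staircase_def)
  show "d = d'" if "(i, d) \<in> ?P" "(i, d') \<in> ?P" for i d d'
  proof (rule local_rule_strip_point_unique[of "?E i" "?E (Suc i)" "N - Suc i" "\<lambda>d. (i, d) \<in> ?P"])
    show "?E i 0 = ?E (Suc i) 0"
      using inside[OF that(1)] by (simp add: backfill_bottom)
  qed (use that inside rule in force)+
  show "i = i'" if "(i, d) \<in> ?P" "(i', d) \<in> ?P" for i i' d
  proof (rule local_rule_strip_point_unique[of "\<lambda>i. ?E i d" "\<lambda>i. ?E i (Suc d)" "N - Suc d"
        "\<lambda>i. (i, d) \<in> ?P"])
    show "?E 0 d = ?E 0 (Suc d)"
      using inside[OF that(1)] by (simp add: backfill_left)
  qed (use that inside local_rule_sym[OF rule] in force)+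
qed

lemma growth_filling_backfill:
  assumes "i + d \<le> N"
  shows "growth (filling N (backfill N c)) i d = backfill N c i d"
  using assms
proof (induction i arbitrary: d)
  case 0
  then show ?case by (simp add: backfill_left)
next
  case (Suc i)
  note left_growth = Suc.IH
  show ?case
    using Suc.prems
  proof (induction d)
    case 0
    then show ?case by (simp add: backfill_bottom)
  next
    case (Suc d)
    then have "backfill N c (Suc i) (Suc d) =
        upper_corner (backfill N c i d) (backfill N c (Suc i) d) (backfill N c i (Suc d))
          ((i, d) \<in> filling N (backfill N c))"
      by (intro local_rule_upper_cornerD local_rule_backfill) simp
    then show ?case
      using Suc left_growth[of d] left_growth[of "Suc d"] by (simp add: growth.simps(3))
  qed
qed

end

definition dual_filling :: "nat \<Rightarrow> (nat \<times> nat) set \<Rightarrow> (nat \<times> nat) set" where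
  "dual_filling N P = filling N (backfill N (\<lambda>i d. conjugate (growth P i d)))"

lemma staircase_boundary_conjugate:
  assumes "matching P"
  shows "staircase_boundary N (\<lambda>i d. conjugate (growth P i d))"
  using is_partition_growth[OF assms] growth_step_right(1)[OF assms] growth_step_up(1)[OF assms]
  by unfold_locales (simp_all add: is_partition_conjugate box_step_conjugate)

lemma dual_filling_subset: "dual_filling N P \<subseteq> staircase N"
  by (auto simp: dual_filling_def filling_def)

lemma matching_dual_filling: "matching P \<Longrightarrow> matching (dual_filling N P)"
  unfolding dual_filling_def
  by (intro staircase_boundary.matching_filling_backfill staircase_boundary_conjugate)

lemma growth_dual_filling:
  assumes "matching P" "i + d \<le> N" "N \<le> Suc (i + d)"
  shows "growth (dual_filling N P) i d = conjugate (growth P i d)"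
  using staircase_boundary.growth_filling_backfill[OF staircase_boundary_conjugate] assms
  by (simp add: dual_filling_def backfill_boundary)

lemma dual_filling_dual_filling:
  assumes "matching P" "P \<subseteq> staircase N"
  shows "dual_filling N (dual_filling N P) = P"
  unfolding dual_filling_def[of N "dual_filling N P"] using assms
  by (rule filling_backfill)
    (simp add: growth_dual_filling conjugate_conjugate is_partition_growth assms(1))

lemma Domain_iff_growth:
  assumes "matching P" "P \<subseteq> staircase N"
  shows "i \<in> Domain P \<longleftrightarrow> growth P (Suc i) (N - Suc i) \<noteq> growth P i (N - Suc i)"
proof -
  have "Suc (i + d) < N" if "(i, d) \<in> P" for d
    using assms(2) that by (auto simp: staircase_def)
  then show ?thesis
    unfolding growth_step_right(2)[OF assms(1)] Domain_iff
    by (metis add.commute add_Suc_right less_diff_conv)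
qed

lemma Range_iff_growth:
  assumes "matching P" "P \<subseteq> staircase N"
  shows "d \<in> Range P \<longleftrightarrow> growth P (N - Suc d) (Suc d) \<noteq> growth P (N - Suc d) d"
proof -
  have "Suc (i + d) < N" if "(i, d) \<in> P" for i
    using assms(2) that by (auto simp: staircase_def)
  then show ?thesis
    unfolding growth_step_up(2)[OF assms(1)] Range_iff by (metis add_Suc_right less_diff_conv)
qed

lemma Domain_dual_filling:
  assumes "matching P" "P \<subseteq> staircase N"
  shows "Domain (dual_filling N P) = Domain P"
proof (rule set_eqI)
  fix i
  show "i \<in> Domain (dual_filling N P) \<longleftrightarrow> i \<in> Domain P"
    using assms
    by (cases "i < N") (simp_all add: Domain_iff_growth[of _ N] matching_dual_filling
        dual_filling_subset growth_dual_filling conjugate_eq_iff is_partition_growth)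
qed

lemma Range_dual_filling:
  assumes "matching P" "P \<subseteq> staircase N"
  shows "Range (dual_filling N P) = Range P"
proof (rule set_eqI)
  fix d
  show "d \<in> Range (dual_filling N P) \<longleftrightarrow> d \<in> Range P"
    using assms
    by (cases "d < N") (simp_all add: Range_iff_growth[of _ N] matching_dual_filling
        dual_filling_subset growth_dual_filling conjugate_eq_iff is_partition_growth)
qed

theorem dual_filling_chain_iff:
  assumes "matching P" "a \<le> N"
  shows "has_chain north_east (dual_filling N P \<inter> {..<a} \<times> {..<N - a}) k \<longleftrightarrow>
    has_chain south_east (P \<inter> {..<a} \<times> {..<N - a}) k"
  using assms
  by (simp add: growth_row_iff growth_column_iff matching_dual_filling growth_dual_filling)

section \<open>Exchanging crossings and nestings of arcs\<close>

lemma transp_lift_Suc: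
  assumes "transp R" "\<And>m. m < n \<Longrightarrow> R (f m) (f (Suc m))" "i < j" "j \<le> n"
  shows "R (f i) (f j)"
  using assms(3,4)
proof (induction j)
  case (Suc j)
  then show ?case
    using assms(1) assms(2)[of j] by (cases "i = j") (auto elim: transpE)
qed simp

lemma ex_fun_pair_iff: "(\<exists>x y. Q x y) \<longleftrightarrow> (\<exists>f. Q (\<lambda>m. fst (f m)) (\<lambda>m. snd (f m)))"
proof
  assume "\<exists>x y. Q x y"
  then obtain x y where "Q x y" by blast
  then show "\<exists>f. Q (\<lambda>m. fst (f m)) (\<lambda>m. snd (f m))"
    by (intro exI[of _ "\<lambda>m. (x m, y m)"]) simp
qed blast

text \<open>
  The arc with index \<open>h\<close> has the first closer of the chain: \<open>h = 0\<close> for crossings and \<open>h = n\<close> for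
  nestings. The last opener serves as the point \<open>v\<close>.
\<close>

lemma has_chain_over_point_iff_fun:
  fixes R :: "'v::linorder \<times> 'v \<Rightarrow> 'v \<times> 'v \<Rightarrow> bool"
  assumes "transp R" and opener: "\<And>p q. R p q \<Longrightarrow> fst p < fst q" and "h \<le> n"
    and closer: "\<And>f m. (\<And>i j. i < j \<Longrightarrow> j \<le> n \<Longrightarrow> R (f i) (f j)) \<Longrightarrow> m \<le> n \<Longrightarrow> snd (f h) \<le> snd (f m)"
  shows "(\<exists>v. has_chain R (A \<inter> {..v} \<times> {v<..}) (Suc n)) \<longleftrightarrow>
    (\<exists>f. (\<forall>m\<le>n. f m \<in> A) \<and> (\<forall>m<n. R (f m) (f (Suc m))) \<and> fst (f n) < snd (f h))"
proof
  assume "\<exists>v. has_chain R (A \<inter> {..v} \<times> {v<..}) (Suc n)"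
  then obtain v f where f: "\<And>m. m \<le> n \<Longrightarrow> f m \<in> A \<inter> {..v} \<times> {v<..}" "\<forall>m<n. R (f m) (f (Suc m))"
    unfolding has_chain_iff_fun[OF assms(1)] by blast
  then have "fst (f n) < snd (f h)"
    using f(1)[of n] f(1)[OF \<open>h \<le> n\<close>] by (auto simp: mem_Times_iff intro: le_less_trans)
  then show "\<exists>f. (\<forall>m\<le>n. f m \<in> A) \<and> (\<forall>m<n. R (f m) (f (Suc m))) \<and> fst (f n) < snd (f h)"
    using f by (intro exI[of _ f]) blast
next
  assume "\<exists>f. (\<forall>m\<le>n. f m \<in> A) \<and> (\<forall>m<n. R (f m) (f (Suc m))) \<and> fst (f n) < snd (f h)"
  then obtain f where f: "\<And>m. m \<le> n \<Longrightarrow> f m \<in> A" "\<And>m. m < n \<Longrightarrow> R (f m) (f (Suc m))"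
    and overlap: "fst (f n) < snd (f h)" by blast
  have chain: "R (f i) (f j)" if "i < j" "j \<le> n" for i j
    using assms(1) f(2) that by (rule transp_lift_Suc)
  then have "fst (f m) \<le> fst (f n)" if "m \<le> n" for m
    using opener[of "f m" "f n"] that by (cases "m = n") auto
  moreover have "snd (f h) \<le> snd (f m)" if "m \<le> n" for m
    using closer[of f m] chain that by blast
  ultimately have "f m \<in> A \<inter> {..fst (f n)} \<times> {fst (f n)<..}" if "m \<le> n" for m
    using f(1) overlap that by (auto simp: mem_Times_iff intro: less_le_trans)
  then show "\<exists>v. has_chain R (A \<inter> {..v} \<times> {v<..}) (Suc n)"
    unfolding has_chain_iff_fun[OF assms(1)] using f(2) by blast
qed

lemma has_k_crossing_iff:
  "has_k_crossing A k \<longleftrightarrow> (\<exists>v. has_chain north_east (A \<inter> {..v} \<times> {v<..}) k)"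
proof (cases k)
  case 0
  then show ?thesis by (simp add: has_k_crossing_def)
next
  case (Suc n)
  have "has_k_crossing A k \<longleftrightarrow>
      (\<exists>f. (\<forall>m\<le>n. f m \<in> A) \<and> (\<forall>m<n. north_east (f m) (f (Suc m))) \<and> fst (f n) < snd (f 0))"
    unfolding has_k_crossing_def north_east_def ex_fun_pair_iff Suc
    by (simp add: less_Suc_eq_le Suc_le_eq)
  also have "\<dots> \<longleftrightarrow> (\<exists>v. has_chain north_east (A \<inter> {..v} \<times> {v<..}) k)"
    unfolding Suc
  proof (intro has_chain_over_point_iff_fun[symmetric] transp_north_east)
    show "snd (f 0) \<le> snd (f m)"
      if "\<And>i j. i < j \<Longrightarrow> j \<le> n \<Longrightarrow> north_east (f i) (f j)" "m \<le> n" for f :: "nat \<Rightarrow> 'a \<times> 'a" and m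
      using that(1)[of 0 m] that(2) by (cases m) (auto simp: north_east_def)
  qed (simp_all add: north_east_def)
  finally show ?thesis .
qed

lemma has_k_nesting_iff:
  "has_k_nesting A k \<longleftrightarrow> (\<exists>v. has_chain south_east (A \<inter> {..v} \<times> {v<..}) k)"
proof (cases k)
  case 0
  then show ?thesis by (simp add: has_k_nesting_def)
next
  case (Suc n)
  have "has_k_nesting A k \<longleftrightarrow>
      (\<exists>f. (\<forall>m\<le>n. f m \<in> A) \<and> (\<forall>m<n. south_east (f m) (f (Suc m))) \<and> fst (f n) < snd (f n))"
    unfolding has_k_nesting_def south_east_def ex_fun_pair_iff Suc
    by (simp add: less_Suc_eq_le Suc_le_eq)
  also have "\<dots> \<longleftrightarrow> (\<exists>v. has_chain south_east (A \<inter> {..v} \<times> {v<..}) k)"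
    unfolding Suc
  proof (intro has_chain_over_point_iff_fun[symmetric] transp_south_east)
    show "snd (f n) \<le> snd (f m)"
      if "\<And>i j. i < j \<Longrightarrow> j \<le> n \<Longrightarrow> south_east (f i) (f j)" "m \<le> n" for f :: "nat \<Rightarrow> 'a \<times> 'a" and m
      using that(1)[of m n] that(2) by (cases "m = n") (auto simp: south_east_def)
  qed (simp_all add: south_east_def)
  finally show ?thesis .
qed

definition arc_set :: "'v::linorder set \<Rightarrow> ('v \<times> 'v) set \<Rightarrow> bool" where
  "arc_set V A \<longleftrightarrow> matching A \<and> A \<subseteq> {(u, v). u \<in> V \<and> v \<in> V \<and> u < v}"

text \<open>Columns count the vertices \<open>L\<close> from the left, rows from the right.\<close>

definition arc_of :: "'v list \<Rightarrow> nat \<times> nat \<Rightarrow> 'v \<times> 'v" where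
  "arc_of L p = (L ! fst p, rev L ! snd p)"

definition swap_arcs :: "'v list \<Rightarrow> ('v \<times> 'v) set \<Rightarrow> ('v \<times> 'v) set" where
  "swap_arcs L A =
     arc_of L ` dual_filling (length L) (arc_of L -` A \<inter> staircase (length L))"

context
  fixes L :: "'v::linorder list"
  assumes sorted: "sorted_wrt (<) L"
begin

lemma nth_less_iff: "i < length L \<Longrightarrow> j < length L \<Longrightarrow> L ! i < L ! j \<longleftrightarrow> i < j"
  using sorted_wrt_nth_less[OF sorted] by (metis less_asym linorder_neqE_nat less_irrefl)

lemma rev_nth_less_iff: "d < length L \<Longrightarrow> e < length L \<Longrightarrow> rev L ! d < rev L ! e \<longleftrightarrow> e < d"
  by (auto simp: rev_nth nth_less_iff)

lemma nth_less_rev_nth_iff: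
  "i < length L \<Longrightarrow> d < length L \<Longrightarrow> L ! i < rev L ! d \<longleftrightarrow> Suc (i + d) < length L"
  by (auto simp: rev_nth nth_less_iff)

lemma north_east_arc_of_iff:
  "p \<in> staircase (length L) \<Longrightarrow> q \<in> staircase (length L) \<Longrightarrow>
    north_east (arc_of L p) (arc_of L q) \<longleftrightarrow> south_east p q"
  and south_east_arc_of_iff:
  "p \<in> staircase (length L) \<Longrightarrow> q \<in> staircase (length L) \<Longrightarrow>
    south_east (arc_of L p) (arc_of L q) \<longleftrightarrow> north_east p q"
  by (auto simp: staircase_def arc_of_def north_east_def south_east_def nth_less_iff
      rev_nth_less_iff)

lemma arc_of_eq_iff:
  assumes "p \<in> staircase (length L)" "q \<in> staircase (length L)"
  shows "fst (arc_of L p) = fst (arc_of L q) \<longleftrightarrow> fst p = fst q"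
    and "snd (arc_of L p) = snd (arc_of L q) \<longleftrightarrow> snd p = snd q"
proof -
  have "distinct L"
    using sorted strict_sorted_iff by blast
  then show "fst (arc_of L p) = fst (arc_of L q) \<longleftrightarrow> fst p = fst q"
    "snd (arc_of L p) = snd (arc_of L q) \<longleftrightarrow> snd p = snd q"
    using assms by (auto simp: arc_of_def staircase_def nth_eq_iff_index_eq)
qed

lemma inj_on_arc_of: "inj_on (arc_of L) (staircase (length L))"
  by (rule inj_onI) (metis arc_of_eq_iff prod_eqI)

lemma arc_of_image_staircase:
  "arc_of L ` staircase (length L) = {(u, v). u \<in> set L \<and> v \<in> set L \<and> u < v}"
proof (intro equalityI subsetI)
  fix e assume "e \<in> {(u, v). u \<in> set L \<and> v \<in> set L \<and> u < v}"
  then obtain u v where e: "e = (u, v)" "u \<in> set L" "v \<in> set (rev L)" "u < v" by auto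
  then obtain i d where "i < length L" "L ! i = u" "d < length L" "rev L ! d = v"
    by (metis in_set_conv_nth length_rev)
  then have "e = arc_of L (i, d)" "(i, d) \<in> staircase (length L)"
    using e nth_less_rev_nth_iff[of i d] by (auto simp: arc_of_def staircase_def)
  then show "e \<in> arc_of L ` staircase (length L)" by blast
next
  fix e assume "e \<in> arc_of L ` staircase (length L)"
  then obtain i d where id: "e = (L ! i, rev L ! d)" "Suc (i + d) < length L"
    by (auto simp: arc_of_def staircase_def)
  then have "rev L ! d \<in> set (rev L)" by (intro nth_mem) simp
  then show "e \<in> {(u, v). u \<in> set L \<and> v \<in> set L \<and> u < v}"
    using id by (simp add: nth_less_rev_nth_iff)
qed

lemma matching_arc_of_image_iff:
  assumes "P \<subseteq> staircase (length L)"
  shows "matching (arc_of L ` P) \<longleftrightarrow> matching P"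
proof -
  have "inj_on (arc_of L) P"
    using inj_on_arc_of assms by (rule inj_on_subset)
  then show ?thesis
    by (simp add: matching_def comp_inj_on_iff inj_on_def[of _ P] arc_of_eq_iff subsetD[OF assms]
        cong: ball_cong)
qed

lemma arc_set_arc_of_image_iff:
  "P \<subseteq> staircase (length L) \<Longrightarrow> arc_set (set L) (arc_of L ` P) \<longleftrightarrow> matching P"
  unfolding arc_set_def arc_of_image_staircase[symmetric]
  by (auto simp: matching_arc_of_image_iff)

lemma arc_setE:
  assumes "arc_set (set L) A"
  obtains P where "matching P" "P \<subseteq> staircase (length L)" "A = arc_of L ` P"
proof -
  obtain P where "P \<subseteq> staircase (length L)" "A = arc_of L ` P"
    using assms unfolding arc_set_def arc_of_image_staircase[symmetric] by (metis subset_imageE)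
  then show ?thesis
    using that assms arc_set_arc_of_image_iff by blast
qed

lemma swap_arcs_image:
  assumes "P \<subseteq> staircase (length L)"
  shows "swap_arcs L (arc_of L ` P) = arc_of L ` dual_filling (length L) P"
proof -
  have "arc_of L -` arc_of L ` P \<inter> staircase (length L) = P"
    using assms inj_on_image_mem_iff[OF inj_on_arc_of _ assms] by blast
  then show ?thesis by (simp add: swap_arcs_def)
qed

lemma arcs_over_eq_image:
  assumes "P \<subseteq> staircase (length L)" "\<And>i. i < length L \<Longrightarrow> L ! i \<le> v \<longleftrightarrow> i < a"
  shows "arc_of L ` P \<inter> {..v} \<times> {v<..} = arc_of L ` (P \<inter> {..<a} \<times> {..<length L - a})"
proof -
  have "arc_of L p \<in> {..v} \<times> {v<..} \<longleftrightarrow> p \<in> {..<a} \<times> {..<length L - a}" if "p \<in> P" for p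
  proof -
    obtain i d where p: "p = (i, d)" "Suc (i + d) < length L"
      using \<open>p \<in> P\<close> assms(1) by (cases p) (auto simp: staircase_def)
    then have "L ! (length L - Suc d) \<le> v \<longleftrightarrow> length L - Suc d < a"
      by (intro assms(2)) simp
    then show ?thesis
      using p assms(2)[of i] by (auto simp: arc_of_def rev_nth)
  qed
  then have "P \<inter> {..<a} \<times> {..<length L - a} = P \<inter> arc_of L -` ({..v} \<times> {v<..})"
    by (intro set_eqI) (simp cong: conj_cong)
  then show ?thesis by (simp only:) blast
qed

lemma ex_count_nth_le: "\<exists>a\<le>length L. \<forall>i<length L. L ! i \<le> v \<longleftrightarrow> i < a"
proof -
  let ?a = "length (takeWhile (\<lambda>u. u \<le> v) L)"
  have "L ! i \<le> v \<longleftrightarrow> i < ?a" if "i < length L" for i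
  proof (cases "i < ?a")
    case True
    then show ?thesis
      using set_takeWhileD[of "L ! i" "\<lambda>u. u \<le> v" L] by (metis nth_mem takeWhile_nth)
  next
    case False
    then have "\<not> L ! ?a \<le> v" "L ! ?a \<le> L ! i"
      using that nth_length_takeWhile[of "\<lambda>u. u \<le> v" L] nth_less_iff[of i ?a] by auto
    then show ?thesis using False by simp
  qed
  then show ?thesis
    using length_takeWhile_le by blast
qed

lemma has_chain_over_point_image_iff:
  assumes "P \<subseteq> staircase (length L)" "\<And>i. i < length L \<Longrightarrow> L ! i \<le> v \<longleftrightarrow> i < a"
    and "\<And>p q. p \<in> staircase (length L) \<Longrightarrow> q \<in> staircase (length L) \<Longrightarrow>
      R (arc_of L p) (arc_of L q) \<longleftrightarrow> R' p q"
  shows "has_chain R (arc_of L ` P \<inter> {..v} \<times> {v<..}) k \<longleftrightarrow>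
    has_chain R' (P \<inter> {..<a} \<times> {..<length L - a}) k"
proof -
  have "has_chain R (arc_of L ` (P \<inter> {..<a} \<times> {..<length L - a})) k \<longleftrightarrow>
      has_chain R' (P \<inter> {..<a} \<times> {..<length L - a}) k"
    using assms(1,3) by (intro has_chain_image_iff) blast
  then show ?thesis
    using arcs_over_eq_image[OF assms(1), of v a] assms(2) by simp
qed

lemma has_chain_over_iff:
  assumes P: "P \<subseteq> staircase (length L)"
    and R: "\<And>p q. p \<in> staircase (length L) \<Longrightarrow> q \<in> staircase (length L) \<Longrightarrow>
      R (arc_of L p) (arc_of L q) \<longleftrightarrow> R' p q"
  shows "(\<exists>v. has_chain R (arc_of L ` P \<inter> {..v} \<times> {v<..}) k) \<longleftrightarrow>
    (\<exists>a\<le>length L. has_chain R' (P \<inter> {..<a} \<times> {..<length L - a}) k)"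
proof
  assume "\<exists>v. has_chain R (arc_of L ` P \<inter> {..v} \<times> {v<..}) k"
  then obtain v where v: "has_chain R (arc_of L ` P \<inter> {..v} \<times> {v<..}) k" by blast
  obtain a where "a \<le> length L" "\<forall>i<length L. L ! i \<le> v \<longleftrightarrow> i < a"
    using ex_count_nth_le by blast
  then show "\<exists>a\<le>length L. has_chain R' (P \<inter> {..<a} \<times> {..<length L - a}) k"
    using v has_chain_over_point_image_iff[OF P, of v a R R', OF _ R] by blast
next
  assume "\<exists>a\<le>length L. has_chain R' (P \<inter> {..<a} \<times> {..<length L - a}) k"
  then obtain a where a: "a \<le> length L" "has_chain R' (P \<inter> {..<a} \<times> {..<length L - a}) k" by blast
  show "\<exists>v. has_chain R (arc_of L ` P \<inter> {..v} \<times> {v<..}) k"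
  proof (cases a)
    case 0
    then have "k = 0" using a(2) by (simp add: has_chain_def)
    then show ?thesis by simp
  next
    case (Suc b)
    then have "L ! i \<le> L ! b \<longleftrightarrow> i < a" if "i < length L" for i
      using a(1) that nth_less_iff[of b i] by auto
    then show ?thesis
      using a(2) has_chain_over_point_image_iff[OF P, of "L ! b" a R R', OF _ R] by blast
  qed
qed

lemma has_k_crossing_arc_of_image_iff:
  "P \<subseteq> staircase (length L) \<Longrightarrow> has_k_crossing (arc_of L ` P) k \<longleftrightarrow>
    (\<exists>a\<le>length L. has_chain south_east (P \<inter> {..<a} \<times> {..<length L - a}) k)"
  unfolding has_k_crossing_iff by (rule has_chain_over_iff) (simp_all add: north_east_arc_of_iff)

lemma has_k_nesting_arc_of_image_iff:
  "P \<subseteq> staircase (length L) \<Longrightarrow> has_k_nesting (arc_of L ` P) k \<longleftrightarrow>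
    (\<exists>a\<le>length L. has_chain north_east (P \<inter> {..<a} \<times> {..<length L - a}) k)"
  unfolding has_k_nesting_iff by (rule has_chain_over_iff) (simp_all add: south_east_arc_of_iff)

lemma arc_set_swap_arcs: "arc_set (set L) A \<Longrightarrow> arc_set (set L) (swap_arcs L A)"
  by (elim arc_setE)
    (simp add: swap_arcs_image arc_set_arc_of_image_iff dual_filling_subset matching_dual_filling)

lemma swap_arcs_swap_arcs: "arc_set (set L) A \<Longrightarrow> swap_arcs L (swap_arcs L A) = A"
  by (elim arc_setE) (simp add: swap_arcs_image dual_filling_subset dual_filling_dual_filling)

lemma Domain_swap_arcs:
  assumes "arc_set (set L) A"
  shows "Domain (swap_arcs L A) = Domain A"
proof -
  obtain P where P: "matching P" "P \<subseteq> staircase (length L)" "A = arc_of L ` P"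
    using assms by (rule arc_setE)
  have "Domain (arc_of L ` Q) = nth L ` Domain Q" for Q
    by (simp add: Domain_fst image_image arc_of_def)
  then show ?thesis
    using P by (simp add: swap_arcs_image Domain_dual_filling)
qed

lemma Range_swap_arcs:
  assumes "arc_set (set L) A"
  shows "Range (swap_arcs L A) = Range A"
proof -
  obtain P where P: "matching P" "P \<subseteq> staircase (length L)" "A = arc_of L ` P"
    using assms by (rule arc_setE)
  have "Range (arc_of L ` Q) = nth (rev L) ` Range Q" for Q
    by (simp add: Range_snd image_image arc_of_def)
  then show ?thesis
    using P by (simp add: swap_arcs_image Range_dual_filling)
qed

theorem has_k_nesting_swap_arcs_iff:
  assumes "arc_set (set L) A"
  shows "has_k_nesting (swap_arcs L A) k \<longleftrightarrow> has_k_crossing A k"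
proof -
  obtain P where P: "matching P" "P \<subseteq> staircase (length L)" "A = arc_of L ` P"
    using assms by (rule arc_setE)
  then show ?thesis
    by (auto simp: swap_arcs_image has_k_nesting_arc_of_image_iff has_k_crossing_arc_of_image_iff
        dual_filling_subset dual_filling_chain_iff)
qed

corollary has_k_crossing_swap_arcs_iff:
  assumes "arc_set (set L) A"
  shows "has_k_crossing (swap_arcs L A) k \<longleftrightarrow> has_k_nesting A k"
  using has_k_nesting_swap_arcs_iff[OF arc_set_swap_arcs[OF assms]] swap_arcs_swap_arcs[OF assms]
  by simp

end

section \<open>Linked cycles\<close>

lemma set_conv_hd_tl: "c \<noteq> [] \<Longrightarrow> set c = insert (hd c) (set (tl c))"
  by (cases c) auto

lemma UN_set_conv_hd_tl:
  "(\<And>c. c \<in> C \<Longrightarrow> c \<noteq> []) \<Longrightarrow> (\<Union>c\<in>C. set c) = hd ` C \<union> (\<Union>c\<in>C. set (tl c))"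
  by (simp add: set_conv_hd_tl) blast

lemma card_set_gt_one_iff: "c \<noteq> [] \<Longrightarrow> distinct c \<Longrightarrow> 1 < card (set c) \<longleftrightarrow> tl c \<noteq> []"
  by (cases c) (auto simp: card_gt_0_iff)

lemma card_Collect_unique:
  assumes "\<And>x y. x \<in> A \<Longrightarrow> y \<in> A \<Longrightarrow> P x \<Longrightarrow> P y \<Longrightarrow> x = y"
  shows "card {x \<in> A. P x} = of_bool (\<exists>x\<in>A. P x)"
proof (cases "\<exists>x\<in>A. P x")
  case True
  then obtain x where "{x \<in> A. P x} = {x}" using assms by blast
  then show ?thesis using True by simp
next
  case False
  then have "{x \<in> A. P x} = {}" by blast
  then show ?thesis using False by (simp only: card.empty of_bool_eq)
qed

locale cycle_linkage =
  fixes n :: nat and C :: "nat list set"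
  assumes finite: "finite C"
    and nonempty: "c \<in> C \<Longrightarrow> c \<noteq> []"
    and distinct: "c \<in> C \<Longrightarrow> distinct c"
    and hd_less: "c \<in> C \<Longrightarrow> i \<in> set (tl c) \<Longrightarrow> hd c < i"
    and hd_unique: "c \<in> C \<Longrightarrow> d \<in> C \<Longrightarrow> hd c = hd d \<Longrightarrow> c = d"
    and tl_unique: "c \<in> C \<Longrightarrow> d \<in> C \<Longrightarrow> i \<in> set (tl c) \<Longrightarrow> i \<in> set (tl d) \<Longrightarrow> c = d"
    and tl_nonempty: "c \<in> C \<Longrightarrow> d \<in> C \<Longrightarrow> hd c \<in> set (tl d) \<Longrightarrow> tl c \<noteq> []"
    and Union: "(\<Union>c\<in>C. set c) = {1..n}"
begin

lemma mem_iff: "c \<in> C \<Longrightarrow> i \<in> set c \<longleftrightarrow> i = hd c \<or> i \<in> set (tl c)"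
  using nonempty set_conv_hd_tl[of c] by auto

lemma covered_iff: "i \<in> {1..n} \<longleftrightarrow> (\<exists>c\<in>C. hd c = i) \<or> (\<exists>c\<in>C. i \<in> set (tl c))"
  unfolding Union[symmetric] by (auto simp: mem_iff)

lemma cover_count_eq:
  "cover_count C i = of_bool (\<exists>c\<in>C. hd c = i) + of_bool (\<exists>c\<in>C. i \<in> set (tl c))"
proof -
  let ?H = "{c \<in> C. hd c = i}" and ?T = "{c \<in> C. i \<in> set (tl c)}"
  have "{c \<in> C. i \<in> set c} = ?H \<union> ?T"
    by (auto simp: mem_iff)
  moreover have "?H \<inter> ?T = {}"
    using hd_less by fastforce
  ultimately have "cover_count C i = card ?H + card ?T"
    unfolding cover_count_def by (simp add: card_Un_disjoint finite)
  also have "card ?H = of_bool (\<exists>c\<in>C. hd c = i)"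
    by (rule card_Collect_unique) (auto intro: hd_unique)
  also have "card ?T = of_bool (\<exists>c\<in>C. i \<in> set (tl c))"
    by (rule card_Collect_unique) (auto intro: tl_unique)
  finally show ?thesis .
qed

lemma Min_eq_hd: "c \<in> C \<Longrightarrow> Min (set c) = hd c"
  by (rule Min_eqI) (auto simp: mem_iff intro: less_imp_le hd_less)

lemma inj_on_set: "inj_on set C"
  by (rule inj_onI) (metis Min_eq_hd hd_unique)

lemma nearly_disjoint_set:
  assumes "c \<in> C" "d \<in> C" "set c \<noteq> set d"
  shows "nearly_disjoint (set c) (set d)"
  unfolding nearly_disjoint_def
proof
  have "c \<noteq> d" using assms(3) by blast
  fix i assume "i \<in> set c \<inter> set d"
  then have "i = hd c \<and> i \<in> set (tl d) \<or> i = hd d \<and> i \<in> set (tl c)"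
    using assms(1,2) \<open>c \<noteq> d\<close> hd_unique[of c d] tl_unique[of c d i] by (auto simp: mem_iff)
  moreover have "1 < card (set c) \<longleftrightarrow> tl c \<noteq> []" "1 < card (set d) \<longleftrightarrow> tl d \<noteq> []"
    using card_set_gt_one_iff nonempty distinct assms by blast+
  ultimately show "i = Min (set c) \<and> 1 < card (set c) \<and> i \<noteq> Min (set d) \<or>
      i = Min (set d) \<and> 1 < card (set d) \<and> i \<noteq> Min (set c)"
    using assms(1,2) \<open>c \<noteq> d\<close> hd_unique tl_nonempty by (auto simp: Min_eq_hd)
qed

lemma card_blocks_containing:
  assumes "i \<in> {1..n}"
  shows "card {B \<in> set ` C. i \<in> B} \<in> {1, 2}"
proof -
  have "{B \<in> set ` C. i \<in> B} = set ` {c \<in> C. i \<in> set c}" by blast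
  moreover have "inj_on set {c \<in> C. i \<in> set c}"
    using inj_on_set by (rule inj_on_subset) simp
  ultimately have "card {B \<in> set ` C. i \<in> B} = cover_count C i"
    unfolding cover_count_def by (simp add: card_image)
  then show ?thesis
    using assms unfolding covered_iff by (auto simp: cover_count_eq)
qed

lemma linked_cycle: "linked_cycle n C"
  unfolding linked_cycle_def linked_partition_def
  using finite nonempty distinct inj_on_set Union nearly_disjoint_set card_blocks_containing
  by (auto simp: Min_eq_hd)

end

lemma cycle_linkage_if_linked_cycle:
  assumes "linked_cycle n C"
  shows "cycle_linkage n C"
proof -
  have C: "c \<noteq> []" "distinct c" "hd c = Min (set c)" if "c \<in> C" for c
    using assms that unfolding linked_cycle_def by auto
  have less: "hd c < i" if "c \<in> C" "i \<in> set (tl c)" for c i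
  proof -
    have "hd c \<noteq> i" "i \<in> set c"
      using C[OF that(1)] that(2) by (cases c; auto)+
    then show ?thesis
      using C(3)[OF that(1)] by (simp add: le_neq_implies_less)
  qed
  have near: "i = hd c \<and> tl c \<noteq> [] \<and> i \<noteq> hd d \<or> i = hd d \<and> tl d \<noteq> [] \<and> i \<noteq> hd c"
    if "c \<in> C" "d \<in> C" "c \<noteq> d" "i \<in> set c" "i \<in> set d" for c d i
  proof -
    have "set c \<noteq> set d"
      using assms that inj_onD unfolding linked_cycle_def by metis
    then have "nearly_disjoint (set c) (set d)"
      using assms that unfolding linked_cycle_def linked_partition_def by blast
    then show ?thesis
      using that C card_set_gt_one_iff unfolding nearly_disjoint_def by (metis IntI)
  qed
  have mem: "hd c \<in> set c" "i \<in> set (tl c) \<Longrightarrow> i \<in> set c" if "c \<in> C" for c i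
    using C(1)[OF that] by (auto dest: list.set_sel)
  show ?thesis
  proof
    show "c = d" if "c \<in> C" "d \<in> C" "hd c = hd d" for c d
      using near[of c d "hd c"] that mem by metis
    show "c = d" if "c \<in> C" "d \<in> C" "i \<in> set (tl c)" "i \<in> set (tl d)" for c d i
      using near[of c d i] that mem less by blast
    show "tl c \<noteq> []" if "c \<in> C" "d \<in> C" "hd c \<in> set (tl d)" for c d
      using near[of c d "hd c"] that mem less by (metis list.set(1) empty_iff less_irrefl)
  qed (use assms C less in \<open>auto simp: linked_cycle_def linked_partition_def\<close>)
qed

theorem linked_cycle_iff: "linked_cycle n C \<longleftrightarrow> cycle_linkage n C"
  using cycle_linkage.linked_cycle cycle_linkage_if_linked_cycle by blast

lemma lr_arcs_iff:
  "((i, j), v) \<in> lr_arcs C \<longleftrightarrow>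
    (\<exists>c\<in>C. \<exists>m<length (tl c). i = hd c \<and> j = Suc m \<and> v = (rev (tl c) ! m, 0))"
proof -
  have "c ! (length c - Suc m) = rev (tl c) ! m" if "m < length (tl c)" for c :: "nat list" and m
    using that by (simp add: rev_nth nth_tl Suc_diff_Suc)
  moreover have "2 \<le> length c \<and> 1 \<le> j \<and> j \<le> length c - 1 \<longleftrightarrow> (\<exists>m<length (tl c). j = Suc m)"
    for c :: "nat list"
    by (cases j) auto
  ultimately show ?thesis
    unfolding lr_arcs_def by fastforce
qed

lemma Range_lr_arcs: "Range (lr_arcs C) = (\<Union>c\<in>C. set (tl c)) \<times> {0}"
proof -
  have "v \<in> Range (lr_arcs C) \<longleftrightarrow> (\<exists>c\<in>C. \<exists>m<length (tl c). v = (rev (tl c) ! m, 0))" for v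
    unfolding Range_iff split_paired_Ex lr_arcs_iff by blast
  moreover have "(\<exists>m<length l. v = (rev l ! m, 0)) \<longleftrightarrow> (\<exists>b\<in>set l. v = (b, 0))"
    for l :: "nat list" and v :: "nat \<times> nat"
    by (metis in_set_conv_nth length_rev set_rev)
  ultimately have "v \<in> Range (lr_arcs C) \<longleftrightarrow> (\<exists>c\<in>C. \<exists>b\<in>set (tl c). v = (b, 0))" for v
    by (simp del: length_tl)
  then show ?thesis by auto
qed

context cycle_linkage
begin

lemma lr_vertices_iff:
  "(i, j) \<in> lr_vertices n C \<longleftrightarrow> j = 0 \<and> (\<exists>c\<in>C. i \<in> set (tl c)) \<or>
     0 < j \<and> (\<exists>c\<in>C. hd c = i \<and> (j = 1 \<or> j \<le> length (tl c)))"
proof (cases "\<exists>c\<in>C. hd c = i")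
  case head: True
  then obtain c where c: "c \<in> C" "hd c = i" by blast
  then have the_head: "(\<exists>d\<in>C. hd d = i \<and> Q d) \<longleftrightarrow> Q c" for Q
    using hd_unique by blast
  show ?thesis
  proof (cases "\<exists>d\<in>C. i \<in> set (tl d)")
    case tail: True
    then have "tl c \<noteq> []" using c tl_nonempty by blast
    then have "1 \<le> length (tl c)" by (cases "tl c") auto
    then show ?thesis
      unfolding lr_vertices_def covered_iff using head tail by (auto simp: cover_count_eq the_head)
  next
    case False
    then have "(THE d. d \<in> C \<and> i \<in> set d) = c"
      using c hd_unique by (intro the_equality) (auto simp: mem_iff)
    then show ?thesis
      unfolding lr_vertices_def covered_iff using head False
      by (auto simp: cover_count_eq the_head Let_def)
  qed
next
  case False
  then show ?thesis
    unfolding lr_vertices_def covered_iff by (auto simp: cover_count_eq)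
qed

lemma finite_lr_vertices: "finite (lr_vertices n C)"
proof (rule finite_subset)
  show "lr_vertices n C \<subseteq> (\<Union>c\<in>C. set c \<times> {..Suc (length c)})"
    using mem_iff by (fastforce simp: lr_vertices_iff)
qed (simp add: finite)

lemma set_vertex_labeling: "set (vertex_labeling n C) = lr_vertices n C"
  using finite_lr_vertices by (simp add: vertex_labeling_def)

lemma lr_arcs_hd_iff:
  "c \<in> C \<Longrightarrow> ((hd c, Suc m), v) \<in> lr_arcs C \<longleftrightarrow> m < length (tl c) \<and> v = (rev (tl c) ! m, 0)"
  unfolding lr_arcs_iff using hd_unique by blast

lemma matching_lr_arcs: "matching (lr_arcs C)"
proof (rule matchingI)
  fix u v v' assume "(u, v) \<in> lr_arcs C" "(u, v') \<in> lr_arcs C"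
  then show "v = v'"
    by (cases u) (auto simp: lr_arcs_iff dest: hd_unique)
next
  fix u u' v assume arcs: "(u, v) \<in> lr_arcs C" "(u', v) \<in> lr_arcs C"
  obtain c m where c: "c \<in> C" "m < length (tl c)" "u = (hd c, Suc m)" "v = (rev (tl c) ! m, 0)"
    using arcs(1) by (cases u) (auto simp: lr_arcs_iff)
  obtain d m' where d: "d \<in> C" "m' < length (tl d)" "u' = (hd d, Suc m')" "v = (rev (tl d) ! m', 0)"
    using arcs(2) by (cases u') (auto simp: lr_arcs_iff)
  have "rev (tl c) ! m \<in> set (tl c)" "rev (tl d) ! m' \<in> set (tl d)"
    using c(2) d(2) nth_mem[of m "rev (tl c)"] nth_mem[of m' "rev (tl d)"] by simp_all
  then have "c = d"
    using c d tl_unique by simp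
  moreover have "distinct (rev (tl c))"
    using distinct[OF c(1)] by (simp add: distinct_tl)
  ultimately show "u = u'"
    using c d nth_eq_iff_index_eq[of "rev (tl c)" m m'] by simp
qed

lemma arc_set_lr_arcs: "arc_set (lr_vertices n C) (lr_arcs C)"
proof -
  have "u \<in> lr_vertices n C \<and> v \<in> lr_vertices n C \<and> u < v" if arc: "(u, v) \<in> lr_arcs C" for u v
  proof -
    obtain c m where c: "c \<in> C" "m < length (tl c)" "u = (hd c, Suc m)" "v = (rev (tl c) ! m, 0)"
      using arc by (cases u) (auto simp: lr_arcs_iff)
    then have "rev (tl c) ! m \<in> set (tl c)"
      using nth_mem[of m "rev (tl c)"] by simp
    then show ?thesis
      using c hd_less by (auto simp: lr_vertices_iff less_prod_def)
  qed
  then show ?thesis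
    unfolding arc_set_def using matching_lr_arcs by blast
qed

end

lemma cycle_subset_if_lr_arcs_eq:
  assumes C: "cycle_linkage n C" and D: "cycle_linkage n D"
    and arcs: "lr_arcs C = lr_arcs D" and vertices: "lr_vertices n C = lr_vertices n D"
  shows "C \<subseteq> D"
proof
  fix c assume c: "c \<in> C"
  interpret C: cycle_linkage n C by (rule C)
  interpret D: cycle_linkage n D by (rule D)
  have "(hd c, 1) \<in> lr_vertices n D"
    unfolding vertices[symmetric] C.lr_vertices_iff using c by auto
  then obtain d where d: "d \<in> D" "hd d = hd c"
    unfolding D.lr_vertices_iff by auto
  have arc_c: "((hd c, Suc m), v) \<in> lr_arcs C \<longleftrightarrow> m < length (tl c) \<and> v = (rev (tl c) ! m, 0)" for m v
    using c by (rule C.lr_arcs_hd_iff)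
  have arc_d: "((hd c, Suc m), v) \<in> lr_arcs C \<longleftrightarrow> m < length (tl d) \<and> v = (rev (tl d) ! m, 0)" for m v
    unfolding arcs using D.lr_arcs_hd_iff[OF d(1)] d(2) by simp
  have "rev (tl c) = rev (tl d)"
  proof (rule nth_equalityI)
    have "m < length (tl c) \<longleftrightarrow> (hd c, Suc m) \<in> Domain (lr_arcs C)" for m
      unfolding Domain_iff arc_c by simp
    moreover have "m < length (tl d) \<longleftrightarrow> (hd c, Suc m) \<in> Domain (lr_arcs C)" for m
      unfolding Domain_iff arc_d by simp
    ultimately have "{..<length (tl c)} = {..<length (tl d)}"
      by (intro set_eqI) (simp del: length_tl)
    then show "length (rev (tl c)) = length (rev (tl d))" by simp
    show "rev (tl c) ! m = rev (tl d) ! m" if "m < length (rev (tl c))" for m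
      using arc_c[of m "(rev (tl c) ! m, 0)"] arc_d[of m "(rev (tl c) ! m, 0)"] that by simp
  qed
  then have "c = d"
    using C.nonempty[OF c] D.nonempty[OF d(1)] d(2) by (metis hd_Cons_tl rev_rev_ident)
  then show "c \<in> D" using d(1) by simp
qed

definition relabel_tail :: "(nat \<Rightarrow> nat) \<Rightarrow> nat list \<Rightarrow> nat list" where
  "relabel_tail \<sigma> c = hd c # map \<sigma> (tl c)"

lemma relabel_tail_simps [simp]:
  "hd (relabel_tail \<sigma> c) = hd c" "tl (relabel_tail \<sigma> c) = map \<sigma> (tl c)"
  by (simp_all add: relabel_tail_def)

lemma lr_arcs_relabel_tail:
  "lr_arcs (relabel_tail \<sigma> ` C) = map_prod id (map_prod \<sigma> id) ` lr_arcs C"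
proof (intro set_eqI)
  fix e :: "(nat \<times> nat) \<times> nat \<times> nat"
  obtain i j v where e: "e = ((i, j), v)" by (metis prod.exhaust)
  have "e \<in> lr_arcs (relabel_tail \<sigma> ` C) \<longleftrightarrow>
      (\<exists>c\<in>C. \<exists>m<length (tl c). i = hd c \<and> j = Suc m \<and> v = (\<sigma> (rev (tl c) ! m), 0))"
    unfolding e lr_arcs_iff by (simp add: rev_map del: length_tl cong: conj_cong)
  also have "\<dots> \<longleftrightarrow> (\<exists>w. ((i, j), w) \<in> lr_arcs C \<and> v = map_prod \<sigma> id w)"
    unfolding lr_arcs_iff by auto
  also have "\<dots> \<longleftrightarrow> e \<in> map_prod id (map_prod \<sigma> id) ` lr_arcs C"
    unfolding e by force
  finally show "e \<in> lr_arcs (relabel_tail \<sigma> ` C) \<longleftrightarrow> e \<in> map_prod id (map_prod \<sigma> id) ` lr_arcs C" .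
qed

context cycle_linkage
begin

context
  fixes \<sigma> :: "nat \<Rightarrow> nat"
  assumes bij: "bij_betw \<sigma> (\<Union>c\<in>C. set (tl c)) (\<Union>c\<in>C. set (tl c))"
begin

lemma tails_relabel_tail: "(\<Union>c\<in>relabel_tail \<sigma> ` C. set (tl c)) = (\<Union>c\<in>C. set (tl c))"
  using bij_betw_imp_surj_on[OF bij] by (simp add: image_UN)

lemma cycle_linkage_relabel_tail:
  assumes "\<And>c b. c \<in> C \<Longrightarrow> b \<in> set (tl c) \<Longrightarrow> hd c < \<sigma> b"
  shows "cycle_linkage n (relabel_tail \<sigma> ` C)"
proof
  have inj: "b = b'"
    if "\<sigma> b = \<sigma> b'" "c \<in> C" "c' \<in> C" "b \<in> set (tl c)" "b' \<in> set (tl c')" for b b' c c'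
    using inj_onD[OF bij_betw_imp_inj_on[OF bij] that(1)] that(2-) by blast
  show "finite (relabel_tail \<sigma> ` C)" using finite by simp
  fix c' assume "c' \<in> relabel_tail \<sigma> ` C"
  then obtain c where c: "c \<in> C" "c' = relabel_tail \<sigma> c" by blast
  show "c' \<noteq> []" by (simp add: c relabel_tail_def)
  show less: "hd c' < i" if "i \<in> set (tl c')" for i
    using assms that by (auto simp: c)
  have "inj_on \<sigma> (set (tl c))"
    using inj c(1) by (blast intro: inj_onI)
  then have "distinct (tl c')"
    using distinct[OF c(1)] by (simp add: c distinct_map distinct_tl)
  then show "distinct c'"
    using less by (cases c') auto
  fix d' assume "d' \<in> relabel_tail \<sigma> ` C"
  then obtain d where d: "d \<in> C" "d' = relabel_tail \<sigma> d" by blast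
  show "c' = d'" if "hd c' = hd d'"
    using that c d hd_unique[of c d] by auto
  show "c' = d'" if "i \<in> set (tl c')" "i \<in> set (tl d')" for i
    using that c d inj tl_unique[of c d] by fastforce
  show "tl c' \<noteq> []" if "hd c' \<in> set (tl d')"
  proof -
    have "hd c \<in> (\<Union>c\<in>C. set (tl c))"
      using that c d unfolding tails_relabel_tail[symmetric] by auto
    then show ?thesis using c tl_nonempty by auto
  qed
next
  have "(\<Union>c\<in>relabel_tail \<sigma> ` C. set c) =
      hd ` relabel_tail \<sigma> ` C \<union> (\<Union>c\<in>relabel_tail \<sigma> ` C. set (tl c))"
    by (rule UN_set_conv_hd_tl) (auto simp: relabel_tail_def)
  also have "\<dots> = hd ` C \<union> (\<Union>c\<in>C. set (tl c))"
    unfolding tails_relabel_tail by (simp add: image_image)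
  also have "\<dots> = {1..n}"
    using UN_set_conv_hd_tl[OF nonempty] Union by simp
  finally show "(\<Union>c\<in>relabel_tail \<sigma> ` C. set c) = {1..n}" .
qed

lemma lr_vertices_relabel_tail:
  assumes "\<And>c b. c \<in> C \<Longrightarrow> b \<in> set (tl c) \<Longrightarrow> hd c < \<sigma> b"
  shows "lr_vertices n (relabel_tail \<sigma> ` C) = lr_vertices n C"
proof -
  interpret relabelled: cycle_linkage n "relabel_tail \<sigma> ` C"
    using assms by (rule cycle_linkage_relabel_tail)
  have "(\<exists>c\<in>relabel_tail \<sigma> ` C. i \<in> set (tl c)) \<longleftrightarrow> (\<exists>c\<in>C. i \<in> set (tl c))" for i
    using tails_relabel_tail by blast
  then have "(i, j) \<in> lr_vertices n (relabel_tail \<sigma> ` C) \<longleftrightarrow> (i, j) \<in> lr_vertices n C" for i j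
    unfolding relabelled.lr_vertices_iff lr_vertices_iff by (simp del: length_tl)
  then show ?thesis by auto
qed

end

end

lemma matching_permute_Range:
  assumes "matching A" "matching B" "Domain A = Domain B"
  shows "\<exists>\<pi>. bij_betw \<pi> (Range B) (Range A) \<and> A = map_prod id \<pi> ` B"
proof -
  define \<pi> where "\<pi> v = (THE w. \<exists>u. (u, v) \<in> B \<and> (u, w) \<in> A)" for v
  have \<pi>: "\<pi> v = w" if "(u, v) \<in> B" "(u, w) \<in> A" for u v w
    unfolding \<pi>_def using that assms(1,2)
    by (blast intro: the_equality dest: matching_fst_unique matching_snd_unique)
  have image: "A = map_prod id \<pi> ` B"
  proof (intro equalityI subrelI)
    fix u w assume "(u, w) \<in> A"
    then obtain v where "(u, v) \<in> B" using assms(3) by blast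
    then show "(u, w) \<in> map_prod id \<pi> ` B"
      using \<pi> \<open>(u, w) \<in> A\<close> by force
  next
    fix u w assume "(u, w) \<in> map_prod id \<pi> ` B"
    then obtain v where v: "(u, v) \<in> B" "w = \<pi> v" by auto
    then obtain w' where "(u, w') \<in> A" using assms(3) by blast
    then show "(u, w) \<in> A" using \<pi> v by blast
  qed
  have "inj_on \<pi> (Range B)"
  proof (rule inj_onI)
    fix v v' assume "v \<in> Range B" "v' \<in> Range B" "\<pi> v = \<pi> v'"
    then obtain u u' where "(u, v) \<in> B" "(u', v') \<in> B" "(u, \<pi> v) \<in> A" "(u', \<pi> v) \<in> A"
      unfolding image by force
    then show "v = v'"
      using assms matching_fst_unique matching_snd_unique by metis
  qed
  moreover have "\<pi> ` Range B = Range A"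
    unfolding image by force
  ultimately show ?thesis
    using image unfolding bij_betw_def by blast
qed

lemma (in cycle_linkage) permute_tails_exists:
  assumes "matching A" "Domain A = Domain (lr_arcs C)" "Range A = Range (lr_arcs C)"
  shows "\<exists>\<sigma>. bij_betw \<sigma> (\<Union>c\<in>C. set (tl c)) (\<Union>c\<in>C. set (tl c)) \<and>
    A = map_prod id (map_prod \<sigma> id) ` lr_arcs C"
proof -
  let ?R = "\<Union>c\<in>C. set (tl c)"
  obtain \<pi> where \<pi>: "bij_betw \<pi> (?R \<times> {0}) (?R \<times> {0})" "A = map_prod id \<pi> ` lr_arcs C"
    using matching_permute_Range[of A "lr_arcs C"] assms matching_lr_arcs
    by (auto simp: Range_lr_arcs)
  define \<sigma> where "\<sigma> = fst \<circ> \<pi> \<circ> (\<lambda>b. (b, 0))"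
  have "bij_betw (\<lambda>b. (b, 0)) ?R (?R \<times> {0})" "bij_betw fst (?R \<times> {0}) ?R"
    by (auto simp: bij_betw_def inj_on_def)
  then have "bij_betw \<sigma> ?R ?R"
    unfolding \<sigma>_def using \<pi>(1) by (blast intro: bij_betw_trans)
  moreover have "\<pi> v = map_prod \<sigma> id v" if "v \<in> Range (lr_arcs C)" for v
    using bij_betw_apply[OF \<pi>(1), of v] that by (auto simp: \<sigma>_def Range_lr_arcs prod_eq_iff)
  then have "map_prod id \<pi> e = map_prod id (map_prod \<sigma> id) e" if "e \<in> lr_arcs C" for e
    using that by (metis RangeI map_prod_simp surj_pair)
  then have "A = map_prod id (map_prod \<sigma> id) ` lr_arcs C"
    unfolding \<pi>(2) by (rule image_cong[OF refl])
  ultimately show ?thesis by blast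
qed

lemma cycle_linkage_of_arcs:
  assumes "cycle_linkage n C" "arc_set V A"
    and "Domain A = Domain (lr_arcs C)" "Range A = Range (lr_arcs C)"
  shows "\<exists>D. cycle_linkage n D \<and> lr_arcs D = A \<and> lr_vertices n D = lr_vertices n C"
proof -
  interpret cycle_linkage n C by (rule assms(1))
  obtain \<sigma> where bij: "bij_betw \<sigma> (\<Union>c\<in>C. set (tl c)) (\<Union>c\<in>C. set (tl c))"
    and image: "A = map_prod id (map_prod \<sigma> id) ` lr_arcs C"
    using permute_tails_exists assms(2-4) unfolding arc_set_def by blast
  have "hd c < \<sigma> b" if c: "c \<in> C" "b \<in> set (tl c)" for c b
  proof -
    obtain m where "m < length (tl c)" "rev (tl c) ! m = b"
      using c(2) by (metis in_set_conv_nth length_rev set_rev)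
    then have "((hd c, Suc m), (b, 0)) \<in> lr_arcs C"
      using c(1) by (simp add: lr_arcs_hd_iff)
    then have "((hd c, Suc m), (\<sigma> b, 0)) \<in> A"
      unfolding image by force
    then show ?thesis
      using assms(2) by (auto simp: arc_set_def)
  qed
  moreover have "lr_arcs (relabel_tail \<sigma> ` C) = A"
    by (simp add: lr_arcs_relabel_tail image)
  ultimately show ?thesis
    using cycle_linkage_relabel_tail[OF bij] lr_vertices_relabel_tail[OF bij] by blast
qed

lemma LC_iff: "C \<in> LC n L \<longleftrightarrow> cycle_linkage n C \<and> vertex_labeling n C = L"
  by (simp add: LC_def linked_cycle_iff)

lemma lr_vertices_LC: "C \<in> LC n L \<Longrightarrow> lr_vertices n C = set L"
  unfolding LC_iff using cycle_linkage.set_vertex_labeling by blast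

lemma arc_set_LC: "C \<in> LC n L \<Longrightarrow> arc_set (set L) (lr_arcs C)"
  by (metis LC_iff cycle_linkage.arc_set_lr_arcs lr_vertices_LC)

lemma inj_on_lr_arcs_LC: "inj_on lr_arcs (LC n L)"
proof (rule inj_onI)
  fix C D assume "C \<in> LC n L" "D \<in> LC n L" "lr_arcs C = lr_arcs D"
  then show "C = D"
    using cycle_subset_if_lr_arcs_eq lr_vertices_LC by (metis LC_iff subset_antisym)
qed

lemma swap_arcs_LC:
  assumes "sorted_wrt (<) L" "A \<in> lr_arcs ` LC n L"
  shows "swap_arcs L A \<in> lr_arcs ` LC n L"
proof -
  obtain C where C: "cycle_linkage n C" "vertex_labeling n C = L" "A = lr_arcs C"
    and arcs: "arc_set (set L) A"
    using assms(2) arc_set_LC by (auto simp: LC_iff)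
  then obtain D where "cycle_linkage n D" "lr_arcs D = swap_arcs L A"
    "lr_vertices n D = lr_vertices n C"
    using cycle_linkage_of_arcs[OF C(1) arc_set_swap_arcs[OF assms(1) arcs]]
      Domain_swap_arcs[OF assms(1) arcs] Range_swap_arcs[OF assms(1) arcs] by auto
  moreover from this have "D \<in> LC n L"
    using C(2) by (simp add: LC_iff vertex_labeling_def)
  ultimately show ?thesis by (metis image_eqI)
qed

lemma sum_swap_arcs:
  assumes "sorted_wrt (<) L"
  shows "(\<Sum>A\<in>lr_arcs ` LC n L. f (swap_arcs L A)) = (\<Sum>A\<in>lr_arcs ` LC n L. f A)"
proof (rule sum.reindex_bij_betw)
  have "\<forall>A\<in>lr_arcs ` LC n L. swap_arcs L (swap_arcs L A) = A"
    by (simp add: swap_arcs_swap_arcs[OF assms arc_set_LC[of _ n]])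
  moreover have "swap_arcs L ` lr_arcs ` LC n L \<subseteq> lr_arcs ` LC n L"
    by (intro image_subsetI swap_arcs_LC[OF assms])
  ultimately show "bij_betw (swap_arcs L) (lr_arcs ` LC n L) (lr_arcs ` LC n L)"
    by (metis bij_betw_byWitness)
qed

theorem theorem4p11:
  fixes n :: nat and L :: "(nat \<times> nat) list" and x y :: "'a :: comm_semiring_1"
  assumes "n \<ge> 1"
    and "\<exists>C. linked_cycle n C \<and> vertex_labeling n C = L"
  shows "(\<Sum>C \<in> LC n L. x ^ cr C * y ^ ne C) = (\<Sum>C \<in> LC n L. x ^ ne C * y ^ cr C)"
proof -
  let ?cr = "\<lambda>A. Max {k. has_k_crossing A k}" and ?ne = "\<lambda>A. Max {k. has_k_nesting A k}"
  let ?arcs = "lr_arcs ` LC n L"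
  have sorted: "sorted_wrt (<) L"
    using assms(2) by (auto simp: vertex_labeling_def)
  have "(\<Sum>C\<in>LC n L. x ^ cr C * y ^ ne C) = (\<Sum>A\<in>?arcs. x ^ ?cr A * y ^ ?ne A)"
    by (simp add: sum.reindex inj_on_lr_arcs_LC cr_def ne_def)
  also have "\<dots> = (\<Sum>A\<in>?arcs. x ^ ?cr (swap_arcs L A) * y ^ ?ne (swap_arcs L A))"
    by (rule sum_swap_arcs[OF sorted, symmetric])
  also have "\<dots> = (\<Sum>A\<in>?arcs. x ^ ?ne A * y ^ ?cr A)"
    using arc_set_LC
    by (intro sum.cong refl) (auto simp: has_k_crossing_swap_arcs_iff[OF sorted]
        has_k_nesting_swap_arcs_iff[OF sorted])
  also have "\<dots> = (\<Sum>C\<in>LC n L. x ^ ne C * y ^ cr C)"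
    by (simp add: sum.reindex inj_on_lr_arcs_LC cr_def ne_def)
  finally show ?thesis .
qed

end
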